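(* Let $(n,2d)=(3,6)$ or $(n,2d)=(4,4)$, and $s=d^{n-1}$. Suppose that $\ell\in H_{n,2d}^*$ spans an extreme ray of $\Sigma_{n,2d}^*$ that does not correspond to point evaluation. Let $W_\ell\subset H_{n,d}$ be the kernel of $Q_\ell$, and suppose that $f_1,\ldots,f_{n-1}\in W_\ell$ intersect transversely in $s$ real projective points $\gamma_1,\ldots,\gamma_s$. Let $v_1,\ldots,v_s\in\mathbb{R}^n$ be affine representatives of $\gamma_1,\ldots,\gamma_s$, and let $u_1p(v_1)+\cdots+u_sp(v_s)=0$ for all $p\in H_{n,d}$, with $u_i\in\mathbb{R}$, be the unique Cayley-Bacharach relation on the points $v_i$. Then the form $Q_\ell$ can be uniquely written as $$Q_\ell(f)=a_1f(v_1)^2+\cdots+a_sf(v_s)^2\quad\text{for } f\in H_{n,d},$$ with a single negative coefficient $a_k$, the rest of the $a_i$ positive, and $$\sum_{i=1}^s\frac{u_i^2}{a_i}=0.$$ Furthermore, any such form (that is, any form $f\mapsto\sum_{i=1}^s a_if(v_i)^2$ with exactly one $a_k$ negative, the rest of the $a_i$ positive, and $\sum_i u_i^2/a_i=0$) is extreme in $\Sigma_{n,2d}^*$.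
   Context: $H_{n,d}$ is the real vector space of real forms (homogeneous polynomials) of degree $d$ in $n$ variables. $\Sigma_{n,2d}=\{p\in H_{n,2d} : p=\sum_i q_i^2 \text{ for some } q_i\in H_{n,d}\}$, and $\Sigma_{n,2d}^*=\{\ell\in H_{n,2d}^* : \ell(p)\ge 0 \text{ for all } p\in\Sigma_{n,2d}\}$. For $\ell\in H_{n,2d}^*$, $Q_\ell$ is the quadratic form on $H_{n,d}$ given by $Q_\ell(f)=\ell(f^2)$; $H_{n,2d}^*$ is identified via $\ell\mapsto Q_\ell$ with a subspace of the quadratic forms on $H_{n,d}$, so one may speak of $Q_\ell$ as an element of $\Sigma_{n,2d}^*$. The functional $\ell$ corresponds to point evaluation if it is (up to a scalar multiple) $f\mapsto f(v)$ for some $v\in\mathbb{R}^n$. "Extreme in $\Sigma_{n,2d}^*$" means spanning an extreme ray. Forms $f_1,\ldots,f_{n-1}\in H_{n,d}$ intersect transversely if their common zero set in $\mathbb{CP}^{n-1}$ is finite and at each common zero their gradients are linearly independent; it then consists of exactly $s=d^{n-1}$ distinct points. Cayley-Bacharach theorem: in the cases $(3,6)$ and $(4,4)$, for affine representatives $z_1,\ldots,z_s$ of these points there is a unique (up to scaling) linear relation $u_1p(z_1)+\cdots+u_sp(z_s)=0$ valid for all $p\in H_{n,d}$, and all $u_i$ are nonzero; if all $z_i$ are real, the $u_i$ can be taken real. *)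

theory Defs
  imports "HOL-Analysis.Analysis" "HOL-Library.Poly_Mapping" "HOL-Analysis.Finite_Function_Topology"
begin

text \<open>Real polynomials in the variables indexed by the finite type \<open>'n\<close>: finitely supported
  maps from exponent vectors to coefficients, with the convolution product and the scalar
  multiplication that the library provides for this type.\<close>

type_synonym 'n rpoly = "('n \<Rightarrow>\<^sub>0 nat) \<Rightarrow>\<^sub>0 real"

definition forms :: "nat \<Rightarrow> 'n::finite rpoly set" where
  "forms d = {p. \<forall>m\<in>Poly_Mapping.keys p. (\<Sum>i\<in>UNIV. Poly_Mapping.lookup m i) = d}"

definition eval_poly :: "'n::finite rpoly \<Rightarrow> 'a::real_field ^ 'n \<Rightarrow> 'a" where
  "eval_poly p z =
     (\<Sum>m\<in>Poly_Mapping.keys p.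
        of_real (Poly_Mapping.lookup p m) * (\<Prod>i\<in>UNIV. (z $ i) ^ Poly_Mapping.lookup m i))"

definition sos_cone :: "nat \<Rightarrow> 'n::finite rpoly set" where
  "sos_cone d = {p \<in> forms (2 * d). \<exists>qs. set qs \<subseteq> forms d \<and> p = (\<Sum>q\<leftarrow>qs. q ^ 2)}"

text \<open>A linear functional on the forms of degree \<open>k\<close> is represented by any function on all
  polynomials that is linear on \<open>forms k\<close>; its values elsewhere are irrelevant, so functionals
  are only ever compared on \<open>forms k\<close>.\<close>

definition forms_dual :: "nat \<Rightarrow> ('n::finite rpoly \<Rightarrow> real) set" where
  "forms_dual k = {l.
     (\<forall>p\<in>forms k. \<forall>q\<in>forms k. l (p + q) = l p + l q) \<and>
     (\<forall>c. \<forall>p\<in>forms k. l (c *\<^sub>R p) = c * l p)}"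

definition sos_dual_cone :: "nat \<Rightarrow> ('n::finite rpoly \<Rightarrow> real) set" where
  "sos_dual_cone d = {l \<in> forms_dual (2 * d). \<forall>p\<in>sos_cone d. 0 \<le> l p}"

text \<open>In a decomposition \<open>l = l1 + l2\<close> it suffices to speak about \<open>l1\<close>, by symmetry.\<close>

definition spans_extreme_ray :: "nat \<Rightarrow> ('n::finite rpoly \<Rightarrow> real) \<Rightarrow> bool" where
  "spans_extreme_ray d l \<longleftrightarrow>
     l \<in> sos_dual_cone d \<and> (\<exists>p\<in>forms (2 * d). l p \<noteq> 0) \<and>
     (\<forall>l1\<in>sos_dual_cone d. \<forall>l2\<in>sos_dual_cone d.
        (\<forall>p\<in>forms (2 * d). l p = l1 p + l2 p) \<longrightarrow>
        (\<exists>c\<ge>0. \<forall>p\<in>forms (2 * d). l1 p = c * l p))"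

definition is_point_evaluation :: "nat \<Rightarrow> ('n::finite rpoly \<Rightarrow> real) \<Rightarrow> bool" where
  "is_point_evaluation d l \<longleftrightarrow>
     (\<exists>c (v :: real ^ 'n). \<forall>p\<in>forms (2 * d). l p = c * eval_poly p v)"

definition quad_form :: "('n::finite rpoly \<Rightarrow> real) \<Rightarrow> 'n rpoly \<Rightarrow> real" where
  "quad_form l f = l (f ^ 2)"

text \<open>The kernel of \<open>quad_form l\<close> on the forms of degree \<open>d\<close> is the radical of its polarization,
  which is the bilinear form \<open>(f, g) \<mapsto> l (f * g)\<close>.\<close>

definition quad_form_kernel :: "nat \<Rightarrow> ('n::finite rpoly \<Rightarrow> real) \<Rightarrow> 'n rpoly set" where
  "quad_form_kernel d l = {f \<in> forms d. \<forall>g\<in>forms d. l (f * g) = 0}"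

text \<open>The point of complex projective space represented by \<open>z \<noteq> 0\<close> is the set of all nonzero
  complex multiples of \<open>z\<close>.\<close>

definition proj_point :: "complex ^ 'n \<Rightarrow> (complex ^ 'n) set" where
  "proj_point z = {c *s z | c. c \<noteq> 0}"

definition common_zeros :: "nat \<Rightarrow> (nat \<Rightarrow> 'n::finite rpoly) \<Rightarrow> (complex ^ 'n) set set" where
  "common_zeros k f = {proj_point z | z. z \<noteq> 0 \<and> (\<forall>i<k. eval_poly (f i) z = 0)}"

text \<open>The \<open>j\<close>-th component is the complex derivative in the \<open>j\<close>-th variable.\<close>

definition gradient :: "'n::finite rpoly \<Rightarrow> complex ^ 'n \<Rightarrow> complex ^ 'n" where
  "gradient p z = (\<chi> j. deriv (\<lambda>t. eval_poly p (\<chi> i. if i = j then t else z $ i)) (z $ j))"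

text \<open>Injectivity makes the last condition linear independence of the family of gradients rather
  than of the set of its values.\<close>

definition intersect_transversely :: "nat \<Rightarrow> (nat \<Rightarrow> 'n::finite rpoly) \<Rightarrow> bool" where
  "intersect_transversely k f \<longleftrightarrow>
     finite (common_zeros k f) \<and>
     (\<forall>z. z \<noteq> 0 \<and> (\<forall>i<k. eval_poly (f i) z = 0) \<longrightarrow>
        inj_on (\<lambda>i. gradient (f i) z) {..<k} \<and>
        vec.independent ((\<lambda>i. gradient (f i) z) ` {..<k}))"

definition complexify :: "real ^ 'n \<Rightarrow> complex ^ 'n" where
  "complexify v = (\<chi> i. complex_of_real (v $ i))"

definition affine_representatives ::
  "nat \<Rightarrow> (nat \<Rightarrow> real ^ 'n) \<Rightarrow> (complex ^ 'n) set set \<Rightarrow> bool" where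
  "affine_representatives s v \<Gamma> \<longleftrightarrow>
     (\<forall>i<s. v i \<noteq> 0) \<and> bij_betw (\<lambda>i. proj_point (complexify (v i))) {..<s} \<Gamma>"

text \<open>A nontrivial relation. That such a relation is unique up to scaling, with all \<open>u i\<close> nonzero,
  is the Cayley-Bacharach theorem and not part of the definition.\<close>

definition cayley_bacharach_relation ::
  "nat \<Rightarrow> nat \<Rightarrow> (nat \<Rightarrow> real ^ 'n::finite) \<Rightarrow> (nat \<Rightarrow> real) \<Rightarrow> bool" where
  "cayley_bacharach_relation d s v u \<longleftrightarrow>
     (\<exists>i<s. u i \<noteq> 0) \<and> (\<forall>p\<in>forms d. (\<Sum>i<s. u i * eval_poly p (v i)) = 0)"

definition represents ::
  "nat \<Rightarrow> nat \<Rightarrow> (nat \<Rightarrow> real ^ 'n::finite) \<Rightarrow> (nat \<Rightarrow> real) \<Rightarrow> ('n rpoly \<Rightarrow> real) \<Rightarrow> bool" where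
  "represents d s v a Q \<longleftrightarrow> (\<forall>f\<in>forms d. Q f = (\<Sum>i<s. a i * (eval_poly f (v i))\<^sup>2))"

definition admissible_coeffs :: "nat \<Rightarrow> (nat \<Rightarrow> real) \<Rightarrow> (nat \<Rightarrow> real) \<Rightarrow> bool" where
  "admissible_coeffs s u a \<longleftrightarrow>
     (\<exists>k<s. a k < 0 \<and> (\<forall>i<s. i \<noteq> k \<longrightarrow> 0 < a i)) \<and> (\<Sum>i<s. (u i)\<^sup>2 / a i) = 0"

end

theory Submission
  imports Defs
begin

text \<open>Every relation among the values of forms of degree \<open>d\<close> at the \<open>s\<close> points has full support:
  as the common zeros are finite, a line contains at most \<open>d\<close> of the points and a conic at most
  \<open>2 * d\<close>, and multiplying a relation by linear forms that vanish at
  some of the points shows that a relation missing a point would violate these bounds. By duality all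
  \<open>x\<close> orthogonal to \<open>u\<close> are the value vectors of forms of degree \<open>d\<close>. Transversality bounds the
  syzygies of the \<open>f k\<close>, and a dimension count shows that a functional on forms of degree \<open>2 * d\<close>
  annihilating the multiples of the \<open>f k\<close> is a combination of the point evaluations. What remains
  is to decide when \<open>\<Sum> a i * (x i)\<^sup>2\<close> is nonnegative on the hyperplane orthogonal to \<open>u\<close> and stays
  so after no subtraction of a square \<open>(x i)\<^sup>2\<close>; the vector \<open>u i / a i\<close> spans its kernel.\<close>

subsection \<open>Evaluation of forms\<close>

text \<open>The bounds on lines and conics come from univariate polynomials with too many roots:
  along a rational curve each \<open>f k\<close> becomes such a polynomial, and the real points of
  the curve alone already contradict finiteness of the complex zero set. What turns relations into
  incidences is the identity \<Sum> w m * v m \<otimes> v m = 0 behind a relation on quadrics: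
  contraction with a covector that vanishes on half of the support traps a point in the span of the
  other half. For quadrics in four variables this acts on the given relation itself. For plane
  cubics one linear factor is still to be spent; chosen to vanish at two of the points, it lowers
  the degree and shrinks the support at once. The dimension count has no slack: the forms that
  isolate single points, the products of the \<open>f k\<close> with \<open>s - 1\<close>
  interpolating forms and the products \<open>f k * f j\<close>, each counted once, are exactly as
  many as the dimension in degree \<open>2 * d\<close> in both cases.\<close>

lemma lookup_scaleR [simp]:
  "Poly_Mapping.lookup (c *\<^sub>R p) m = c *\<^sub>R Poly_Mapping.lookup p m"
proof -
  have "finite {i. c *\<^sub>R Poly_Mapping.lookup p i \<noteq> 0}"
    by (rule finite_subset[OF _ finite_lookup[of p]]) auto
  then show ?thesis
    by (simp add: scaleR_poly_mapping_def)
qed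

definition monom_val :: "('n::finite \<Rightarrow>\<^sub>0 nat) \<Rightarrow> 'a::real_field ^ 'n \<Rightarrow> 'a" where
  "monom_val m z = (\<Prod>i\<in>UNIV. (z $ i) ^ Poly_Mapping.lookup m i)"

lemma monom_val_0 [simp]: "monom_val 0 z = 1"
  by (simp add: monom_val_def)

lemma monom_val_add: "monom_val (m + m') z = monom_val m z * monom_val m' z"
  by (simp add: monom_val_def lookup_add power_add prod.distrib)

lemma eval_poly_superset:
  assumes "finite A" "Poly_Mapping.keys p \<subseteq> A"
  shows "eval_poly p z = (\<Sum>m\<in>A. of_real (Poly_Mapping.lookup p m) * monom_val m z)"
  unfolding eval_poly_def monom_val_def
  by (rule sum.mono_neutral_left) (use assms in \<open>auto simp: in_keys_iff\<close>)

lemma eval_poly_0 [simp]: "eval_poly 0 z = 0"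
  by (simp add: eval_poly_def)

lemma eval_poly_add [simp]: "eval_poly (p + q) z = eval_poly p z + eval_poly q z"
proof -
  let ?A = "Poly_Mapping.keys p \<union> Poly_Mapping.keys q"
  have "Poly_Mapping.keys (p + q) \<subseteq> ?A" by (rule keys_add)
  then show ?thesis
    by (simp add: eval_poly_superset[of ?A] lookup_add distrib_right sum.distrib)
qed

lemma eval_poly_scaleR [simp]: "eval_poly (c *\<^sub>R p) z = of_real c * eval_poly p z"
proof -
  have "Poly_Mapping.keys (c *\<^sub>R p) \<subseteq> Poly_Mapping.keys p"
    by (auto simp: in_keys_iff)
  then show ?thesis
    by (simp add: eval_poly_superset[of "Poly_Mapping.keys p"] sum_distrib_left mult_ac)
qed

lemma eval_poly_single: "eval_poly (Poly_Mapping.single m c) z = of_real c * monom_val m z"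
  by (cases "c = 0") (simp_all add: eval_poly_superset[of "{m}"])

lemma eval_poly_sum [simp]: "eval_poly (sum g A) z = (\<Sum>a\<in>A. eval_poly (g a) z)"
  by (induction A rule: infinite_finite_induct) auto

lemma poly_mapping_expand:
  "p = (\<Sum>m\<in>Poly_Mapping.keys p. Poly_Mapping.single m (Poly_Mapping.lookup p m))"
proof (rule poly_mapping_eqI)
  fix k
  have "(\<Sum>m\<in>Poly_Mapping.keys p. Poly_Mapping.lookup (Poly_Mapping.single m (Poly_Mapping.lookup p m)) k)
     = (\<Sum>m\<in>Poly_Mapping.keys p. if m = k then Poly_Mapping.lookup p m else 0)"
    by (rule sum.cong) (auto simp: lookup_single when_def)
  then show "Poly_Mapping.lookup p k = Poly_Mapping.lookup (\<Sum>m\<in>Poly_Mapping.keys p.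
      Poly_Mapping.single m (Poly_Mapping.lookup p m)) k"
    by (simp add: lookup_sum in_keys_iff)
qed

lemma eval_poly_mult [simp]: "eval_poly (p * q) z = eval_poly p z * eval_poly q z"
proof -
  let ?s = "\<lambda>p m. Poly_Mapping.single m (Poly_Mapping.lookup p m)"
  have "p * q = (\<Sum>m\<in>Poly_Mapping.keys p. ?s p m) * (\<Sum>m\<in>Poly_Mapping.keys q. ?s q m)"
    using poly_mapping_expand[of p] poly_mapping_expand[of q] by simp
  also have "\<dots> = (\<Sum>m\<in>Poly_Mapping.keys p. \<Sum>m'\<in>Poly_Mapping.keys q.
      Poly_Mapping.single (m + m') (Poly_Mapping.lookup p m * Poly_Mapping.lookup q m'))"
    by (simp add: sum_product mult_single)
  finally have *: "p * q = \<dots>" .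
  show ?thesis
    unfolding * by (simp add: eval_poly_single monom_val_add eval_poly_superset[of "Poly_Mapping.keys p"]
        eval_poly_superset[of "Poly_Mapping.keys q"] sum_product mult_ac)
qed

lemma eval_poly_1 [simp]: "eval_poly 1 z = 1"
  using eval_poly_single[of 0 1 z] by simp

lemma eval_poly_power [simp]: "eval_poly (p ^ k) z = eval_poly p z ^ k"
  by (induction k) simp_all

lemma eval_poly_complexify:
  "eval_poly p (complexify v) = complex_of_real (eval_poly p v)"
  by (simp add: eval_poly_def complexify_def)

lemma subspace_forms: "subspace (forms d :: 'n::finite rpoly set)"
proof (rule subspaceI)
  fix x y :: "'n rpoly" assume "x \<in> forms d" "y \<in> forms d"
  then show "x + y \<in> forms d"
    using keys_add[of x y] unfolding forms_def by blast
qed (auto simp: forms_def in_keys_iff)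

lemmas forms_add = subspace_add[OF subspace_forms]
  and forms_scale = subspace_scale[OF subspace_forms]
  and forms_zero = subspace_0[OF subspace_forms]
  and forms_sum = subspace_sum[OF subspace_forms]

lemma forms_mult:
  assumes "p \<in> forms d" "q \<in> forms e" shows "p * q \<in> forms (d + e)"
  unfolding forms_def
proof (intro CollectI ballI)
  fix m assume "m \<in> Poly_Mapping.keys (p * q)"
  then obtain a b where "m = a + b" "a \<in> Poly_Mapping.keys p" "b \<in> Poly_Mapping.keys q"
    using keys_mult[of p q] by blast
  then show "(\<Sum>i\<in>UNIV. Poly_Mapping.lookup m i) = d + e"
    using assms by (simp add: forms_def lookup_add sum.distrib)
qed

lemma forms_power2: "p \<in> forms d \<Longrightarrow> p ^ 2 \<in> forms (2 * d)"
  using forms_mult[of p d p d] by (simp add: power2_eq_square mult_2)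

definition linear_form :: "real ^ 'n \<Rightarrow> 'n::finite rpoly" where
  "linear_form a = (\<Sum>i\<in>UNIV. Poly_Mapping.single (Poly_Mapping.single i 1) (a $ i))"

lemma linear_form_forms: "linear_form a \<in> forms 1"
  unfolding linear_form_def
  by (intro forms_sum) (auto simp: forms_def lookup_single when_def split: if_splits)

lemma eval_linear_form [simp]: "eval_poly (linear_form a) v = a \<bullet> v" for v :: "real ^ 'n::finite"
proof -
  have "monom_val (Poly_Mapping.single i 1) v = v $ i" for i
  proof -
    have "monom_val (Poly_Mapping.single i 1) v = (\<Prod>j\<in>UNIV. if j = i then v $ j else 1)"
      unfolding monom_val_def by (rule prod.cong) (auto simp: lookup_single when_def)
    then show ?thesis by simp
  qed
  then show ?thesis
    by (simp add: linear_form_def eval_poly_single inner_vec_def)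
qed

lemma eval_poly_scale_arg:
  assumes "p \<in> forms d"
  shows "eval_poly p (c *s z) = c ^ d * eval_poly p z"
proof -
  have "monom_val m (c *s z) = c ^ d * monom_val m z" if "m \<in> Poly_Mapping.keys p" for m
  proof -
    have "(\<Prod>i\<in>UNIV. c ^ Poly_Mapping.lookup m i) = c ^ d"
      using that assms unfolding power_sum[symmetric] by (simp add: forms_def)
    then show ?thesis
      by (simp add: monom_val_def power_mult_distrib prod.distrib)
  qed
  then show ?thesis
    by (simp add: eval_poly_superset[of "Poly_Mapping.keys p"] sum_distrib_left mult_ac)
qed

lemma poly_mapping_scaleR_mult:
  fixes p q :: "'n::finite rpoly"
  shows "(c *\<^sub>R p) * q = c *\<^sub>R (p * q)" "p * (c *\<^sub>R q) = c *\<^sub>R (p * q)"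
proof -
  have c: "c *\<^sub>R p = Poly_Mapping.single 0 c * p" for p :: "'n rpoly"
    by (rule poly_mapping_eqI) (simp flip: mult_map_scale_conv_mult add: map.rep_eq when_def)
  show "(c *\<^sub>R p) * q = c *\<^sub>R (p * q)" "p * (c *\<^sub>R q) = c *\<^sub>R (p * q)"
    unfolding c[of p] c[of q] c[of "p * q"] by (simp_all add: mult_ac)
qed

section \<open>Dimension bounds for spaces of forms\<close>

lemma card_exponents:
  "finite {m :: 'n::finite \<Rightarrow>\<^sub>0 nat. (\<Sum>i\<in>UNIV. Poly_Mapping.lookup m i) = d}"
  "card {m :: 'n::finite \<Rightarrow>\<^sub>0 nat. (\<Sum>i\<in>UNIV. Poly_Mapping.lookup m i) = d}
     = (d + CARD('n) - 1) choose d"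
proof -
  obtain xs :: "'n list" where xs: "set xs = UNIV" "distinct xs"
    using finite_distinct_list[of "UNIV :: 'n set"] by auto
  have len: "length xs = CARD('n)"
    using xs distinct_card by fastforce
  define F where "F = (\<lambda>m :: 'n \<Rightarrow>\<^sub>0 nat. map (Poly_Mapping.lookup m) xs)"
  let ?M = "{m :: 'n \<Rightarrow>\<^sub>0 nat. (\<Sum>i\<in>UNIV. Poly_Mapping.lookup m i) = d}"
  let ?L = "{l :: nat list. length l = CARD('n) \<and> sum_list l = d}"
  have sum: "sum_list (F m) = (\<Sum>i\<in>UNIV. Poly_Mapping.lookup m i)" for m
    unfolding F_def using xs by (simp add: sum_list_distinct_conv_sum_set)
  have inj: "inj F"
    by (rule injI, rule poly_mapping_eqI) (use xs in \<open>auto simp: F_def\<close>)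
  have "l \<in> F ` ?M" if l: "l \<in> ?L" for l
  proof -
    define h where "h = (\<lambda>i. the (map_of (zip xs l) i))"
    have "map h xs = l"
    proof (rule nth_equalityI)
      fix i assume "i < length (map h xs)"
      then show "map h xs ! i = l ! i"
        using l len xs by (simp add: h_def map_of_zip_nth)
    qed (use l len in simp)
    moreover have "Poly_Mapping.lookup (Abs_poly_mapping h) = h"
      by (rule lookup_Abs_poly_mapping) simp
    ultimately have "F (Abs_poly_mapping h) = l"
      by (simp add: F_def)
    then show ?thesis using sum[of "Abs_poly_mapping h"] l by force
  qed
  then have im: "F ` ?M = ?L"
    using sum len by (auto simp: F_def)
  then have bij: "bij_betw F ?M ?L"
    using inj by (auto simp: bij_betw_def intro: inj_on_subset)
  have eq: "card ?M = (d + CARD('n) - 1) choose d"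
    using bij_betw_same_card[OF bij] card_length_sum_list[of "CARD('n)" d] by simp
  then show "card ?M = (d + CARD('n) - 1) choose d" .
  have "0 < CARD('n)" by (simp add: card_gt_0_iff)
  then have "d \<le> d + CARD('n) - 1" by linarith
  \<comment> \<open>Infinite sets have cardinality 0, so a positive binomial coefficient yields
    finiteness.\<close>
  then have "card ?M > 0" by (simp add: eq)
  then show "finite ?M" by (rule card_ge_0_finite)
qed

lemma forms_subset_span:
  "forms d \<subseteq> span ((\<lambda>m :: 'n::finite \<Rightarrow>\<^sub>0 nat. Poly_Mapping.single m 1)
     ` {m. (\<Sum>i\<in>UNIV. Poly_Mapping.lookup m i) = d})"
  (is "_ \<subseteq> span (?s ` ?M)")
proof
  fix p :: "'n rpoly" assume p: "p \<in> forms d"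
  have sc: "Poly_Mapping.single m c = c *\<^sub>R Poly_Mapping.single m (1::real)" for m :: "'n \<Rightarrow>\<^sub>0 nat" and c
    by (rule poly_mapping_eqI) (auto simp: lookup_single when_def)
  have "(\<Sum>m\<in>Poly_Mapping.keys p. Poly_Mapping.single m (Poly_Mapping.lookup p m)) \<in> span (?s ` ?M)"
    unfolding sc[of _ "Poly_Mapping.lookup p _"] by (intro span_sum span_scale span_base) (use p in \<open>auto simp: forms_def\<close>)
  then show "p \<in> span (?s ` ?M)"
    by (subst poly_mapping_expand)
qed

text \<open>The monomials of degree \<open>d\<close> span and are counted by the binomial
  coefficient. The family is indexed because coincidences among its members cannot be excluded
  beforehand; two equal members already give a relation with coefficients 1 and -1.\<close>

lemma forms_linear_relation:
  fixes x :: "'i \<Rightarrow> 'n::finite rpoly"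
  assumes I: "finite I" "(d + CARD('n) - 1) choose d < card I" and x: "\<And>i. i \<in> I \<Longrightarrow> x i \<in> forms d"
  obtains c where "\<exists>i\<in>I. c i \<noteq> 0" "(\<Sum>i\<in>I. c i *\<^sub>R x i) = 0"
proof (cases "inj_on x I")
  case True
  let ?B = "(\<lambda>m :: 'n \<Rightarrow>\<^sub>0 nat. Poly_Mapping.single m (1::real))
     ` {m. (\<Sum>i\<in>UNIV. Poly_Mapping.lookup m i) = d}"
  have "finite ?B"
    by (intro finite_imageI card_exponents)
  moreover have "card ?B \<le> (d + CARD('n) - 1) choose d"
    unfolding card_exponents(2)[symmetric] by (intro card_image_le card_exponents)
  moreover have "x ` I \<subseteq> span ?B"
    using forms_subset_span x by blast
  ultimately have "dependent (x ` I)"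
    using independent_span_bound[of ?B "x ` I"] card_image[OF True] I by linarith
  then obtain c where c: "\<exists>y\<in>x ` I. c y \<noteq> 0" "(\<Sum>y\<in>x ` I. c y *\<^sub>R y) = 0"
    using dependent_finite[of "x ` I"] I by auto
  show ?thesis
    by (rule that[of "c \<circ> x"]) (use c sum.reindex[OF True, of "\<lambda>y. c y *\<^sub>R y"] in auto)
next
  case False
  then obtain i j where ij: "i \<in> I" "j \<in> I" "i \<noteq> j" "x i = x j"
    by (auto simp: inj_on_def)
  let ?c = "\<lambda>k. if k = i then 1 else if k = j then -1 else (0::real)"
  have "(\<Sum>k\<in>I. ?c k *\<^sub>R x k) = (\<Sum>k\<in>I. (if k = i then x k else 0) - (if k = j then x k else 0))"
    by (rule sum.cong) (use ij in auto)
  also have "\<dots> = 0"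
    using ij I by (simp add: sum_subtractf)
  finally show ?thesis
    using that[of ?c] ij by fastforce
qed

subsection \<open>Forms on rational curves\<close>

text \<open>\<open>a\<close> and \<open>b\<close> are formal degrees; the true degrees may be
  smaller. The coefficient at the formal degree is still multiplicative, and it stands for the value
  of a parametrized curve at infinity.\<close>

lemma coeff_mult_bound:
  fixes p q :: "'a::comm_semiring_1 poly"
  assumes "degree p \<le> a" "degree q \<le> b"
  shows "coeff (p * q) (a + b) = coeff p a * coeff q b"
proof -
  have "coeff p i * coeff q (a + b - i) = (if i = a then coeff p a * coeff q b else 0)"
    if "i \<le> a + b" for i
  proof (cases i a rule: linorder_cases)
    case less
    then have "coeff q (a + b - i) = 0"
      using assms by (intro coeff_eq_0) linarith
    then show ?thesis using less by simp
  next
    case greater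
    then have "coeff p i = 0"
      using assms by (intro coeff_eq_0) linarith
    then show ?thesis using greater by simp
  qed simp
  then have "coeff (p * q) (a + b) = (\<Sum>i\<le>a + b. if i = a then coeff p a * coeff q b else 0)"
    unfolding coeff_mult by (intro sum.cong) auto
  then show ?thesis by simp
qed

lemma degree_coeff_power_bound:
  fixes p :: "'a::comm_semiring_1 poly"
  assumes "degree p \<le> e"
  shows "degree (p ^ k) \<le> k * e \<and> coeff (p ^ k) (k * e) = coeff p e ^ k"
proof (induction k)
  case (Suc k)
  then have "degree (p * p ^ k) \<le> e + k * e"
    using degree_mult_le[of p "p ^ k"] assms by linarith
  then show ?case
    using Suc coeff_mult_bound[OF assms, of "p ^ k" "k * e"] by simp
qed simp

lemma degree_coeff_prod_bound:
  fixes p :: "'i \<Rightarrow> 'a::comm_semiring_1 poly"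
  assumes "finite A" "\<And>i. i \<in> A \<Longrightarrow> degree (p i) \<le> e i"
  shows "degree (\<Prod>i\<in>A. p i) \<le> (\<Sum>i\<in>A. e i) \<and>
    coeff (\<Prod>i\<in>A. p i) (\<Sum>i\<in>A. e i) = (\<Prod>i\<in>A. coeff (p i) (e i))"
  using assms
proof (induction A rule: finite_induct)
  case (insert x A)
  have "degree (p x * (\<Prod>i\<in>A. p i)) \<le> e x + (\<Sum>i\<in>A. e i)"
    using insert degree_mult_le[of "p x" "\<Prod>i\<in>A. p i"] by fastforce
  then show ?case
    using insert coeff_mult_bound[of "p x" "e x" "\<Prod>i\<in>A. p i" "\<Sum>i\<in>A. e i"] by simp
qed simp

text \<open>By homogeneity every monomial of \<open>p\<close> pulls back to formal degree
  \<open>d * e\<close>, even if some coordinates drop in degree. The top coefficient of the pullback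
  is therefore \<open>p\<close> at the vector of top coefficients, the point at infinity.\<close>

lemma form_along_curve:
  fixes c :: "'n::finite \<Rightarrow> real poly"
  assumes p: "p \<in> forms d" and deg: "\<And>i. degree (c i) \<le> e"
  obtains q where "degree q \<le> d * e" "coeff q (d * e) = eval_poly p (\<chi> i. coeff (c i) e)"
    "\<And>t. poly q t = eval_poly p (\<chi> i. poly (c i) t)"
proof -
  let ?P = "\<lambda>m. \<Prod>i\<in>UNIV. c i ^ Poly_Mapping.lookup m i"
  define q where "q = (\<Sum>m\<in>Poly_Mapping.keys p. smult (Poly_Mapping.lookup p m) (?P m))"
  have m: "degree (?P m) \<le> d * e \<and> coeff (?P m) (d * e) = monom_val m (\<chi> i. coeff (c i) e)"
    if "m \<in> Poly_Mapping.keys p" for m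
  proof -
    have "(\<Sum>i\<in>UNIV. Poly_Mapping.lookup m i * e) = d * e"
      using that p by (simp add: forms_def sum_distrib_right[symmetric])
    then show ?thesis
      using degree_coeff_prod_bound[of UNIV "\<lambda>i. c i ^ Poly_Mapping.lookup m i"
        "\<lambda>i. Poly_Mapping.lookup m i * e"] degree_coeff_power_bound[OF deg]
      by (simp add: monom_val_def)
  qed
  show ?thesis
  proof (rule that[of q])
    show "degree q \<le> d * e"
      unfolding q_def
      by (intro degree_sum_le order_trans[OF degree_smult_le]) (use m in simp_all)
    show "coeff q (d * e) = eval_poly p (\<chi> i. coeff (c i) e)"
      using m by (simp add: q_def coeff_sum eval_poly_superset[of "Poly_Mapping.keys p"])
    show "poly q t = eval_poly p (\<chi> i. poly (c i) t)" for t
      by (simp add: q_def poly_sum poly_prod eval_poly_superset[of "Poly_Mapping.keys p"] monom_val_def)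
  qed
qed

text \<open>The coefficient vector of \<open>t ^ e\<close> is the point of the curve at \<open>t = \<infinity>\<close>; it counts as one of
  the \<open>d * e + 1\<close> zeros.\<close>

lemma form_vanishes_on_curve:
  fixes c :: "'n::finite \<Rightarrow> real poly"
  assumes p: "p \<in> forms d" and deg: "\<And>i. degree (c i) \<le> e" and "0 < d * e"
    and lead: "eval_poly p (\<chi> i. coeff (c i) e) = 0"
    and T: "finite T" "d * e \<le> card T" "\<And>t. t \<in> T \<Longrightarrow> eval_poly p (\<chi> i. poly (c i) t) = 0"
  shows "eval_poly p (\<chi> i. poly (c i) t) = 0"
proof -
  obtain q where q: "degree q \<le> d * e" "coeff q (d * e) = eval_poly p (\<chi> i. coeff (c i) e)"
    "\<And>t. poly q t = eval_poly p (\<chi> i. poly (c i) t)"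
    using form_along_curve[where c = c and e = e, OF p deg] by blast
  have "q = 0"
  proof (rule ccontr)
    assume "q \<noteq> 0"
    then have "degree q \<noteq> d * e"
      using q(2) lead by (metis leading_coeff_0_iff)
    then have "degree q < card T" using q(1) T(2) by linarith
    moreover have "card T \<le> card {t. poly q t = 0}"
      by (rule card_mono[OF poly_roots_finite[OF \<open>q \<noteq> 0\<close>]]) (use T q(3) in auto)
    ultimately show False
      using card_poly_roots_bound[OF \<open>q \<noteq> 0\<close>] by linarith
  qed
  then show ?thesis using q(3)[of t] by simp
qed

subsection \<open>The configuration of points\<close>

text \<open>A complex proportionality factor between two real vectors may be replaced by its real
  part.\<close>

lemma proj_point_complexify_eqD:
  assumes "proj_point (complexify x) = proj_point (complexify y)"
  shows "\<exists>c. x = c *\<^sub>R y"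
proof -
  have "complexify x = 1 *s complexify x" by simp
  then have "complexify x \<in> proj_point (complexify x)"
    unfolding proj_point_def by (metis (mono_tags, lifting) mem_Collect_eq one_neq_zero)
  then obtain c where "complexify x = c *s complexify y"
    unfolding assms by (auto simp: proj_point_def)
  then have "complex_of_real (x $ i) = c * complex_of_real (y $ i)" for i
    by (auto simp: complexify_def vec_eq_iff)
  from arg_cong[OF this, of Re] have "x $ i = Re c * y $ i" for i
    by simp
  then show ?thesis by (intro exI[of _ "Re c"]) (simp add: vec_eq_iff)
qed

lemma proj_point_scale:
  assumes "c \<noteq> 0" shows "proj_point (c *s z) = proj_point z"
proof -
  have "\<exists>b. a *s z = b *s (c *s z) \<and> b \<noteq> 0" if "a \<noteq> 0" for a
    using that assms by (intro exI[of _ "a / c"]) simp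
  moreover have "\<exists>b. a *s (c *s z) = b *s z \<and> b \<noteq> 0" if "a \<noteq> 0" for a
    using that assms by (intro exI[of _ "a * c"]) simp
  ultimately show ?thesis
    unfolding proj_point_def by auto
qed

lemma complexify_scaleR: "complexify (c *\<^sub>R x) = complex_of_real c *s complexify x"
  by (simp add: complexify_def vec_eq_iff)

lemma complexify_eq_0_iff [simp]: "complexify x = 0 \<longleftrightarrow> x = 0"
  by (simp add: complexify_def vec_eq_iff)

text \<open>The number of variables, \<open>d\<close> and \<open>s\<close> stay open, so that the
  arguments on curves and hyperplanes serve plane cubics and space quadrics alike.\<close>

locale point_configuration =
  fixes d s :: nat and f :: "nat \<Rightarrow> 'n::finite rpoly" and v :: "nat \<Rightarrow> real ^ 'n"
  assumes d_pos: "0 < d"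
    and f_forms: "\<And>k. k < CARD('n) - 1 \<Longrightarrow> f k \<in> forms d"
    and transversal: "intersect_transversely (CARD('n) - 1) f"
    and reps: "affine_representatives s v (common_zeros (CARD('n) - 1) f)"
begin

lemma v_nonzero: "i < s \<Longrightarrow> v i \<noteq> 0"
  using reps by (simp add: affine_representatives_def)

lemma v_nonparallel:
  assumes "i < s" "j < s" "v i = c *\<^sub>R v j" shows "i = j"
proof -
  have "c \<noteq> 0" using v_nonzero[OF assms(1)] assms(3) by auto
  then have "proj_point (complexify (v i)) = proj_point (complexify (v j))"
    by (simp add: assms(3) complexify_scaleR proj_point_scale)
  moreover have "inj_on (\<lambda>i. proj_point (complexify (v i))) {..<s}"
    using reps by (simp add: affine_representatives_def bij_betw_def)
  ultimately show ?thesis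
    using assms by (intro inj_onD[of "\<lambda>i. proj_point (complexify (v i))" "{..<s}"]) auto
qed

lemma f_zero:
  assumes "i < s" "k < CARD('n) - 1" shows "eval_poly (f k) (v i) = 0"
proof -
  let ?z = "complexify (v i)"
  have "proj_point ?z \<in> common_zeros (CARD('n) - 1) f"
    using reps assms(1) by (auto simp: affine_representatives_def bij_betw_def)
  then obtain z where z: "proj_point ?z = proj_point z" "\<forall>k<CARD('n) - 1. eval_poly (f k) z = 0"
    by (auto simp: common_zeros_def)
  have "1 *s ?z \<in> proj_point ?z" unfolding proj_point_def using one_neq_zero by blast
  then obtain c where "?z = c *s z" unfolding z(1) by (auto simp: proj_point_def)
  then have "eval_poly (f k) ?z = 0"
    using z(2) assms(2) by (simp add: eval_poly_scale_arg[OF f_forms])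
  then show ?thesis by (simp add: eval_poly_complexify)
qed

lemma no_common_curve:
  fixes \<phi> :: "real \<Rightarrow> real ^ 'n"
  assumes "infinite T" and nz: "\<And>t. t \<in> T \<Longrightarrow> \<phi> t \<noteq> 0"
    and zero: "\<And>t k. t \<in> T \<Longrightarrow> k < CARD('n) - 1 \<Longrightarrow> eval_poly (f k) (\<phi> t) = 0"
    and inj: "\<And>t t' c. t \<in> T \<Longrightarrow> t' \<in> T \<Longrightarrow> \<phi> t = c *\<^sub>R \<phi> t' \<Longrightarrow> t = t'"
  shows False
proof -
  have "inj_on (\<lambda>t. proj_point (complexify (\<phi> t))) T"
    using inj proj_point_complexify_eqD by (intro inj_onI) blast
  moreover have "(\<lambda>t. proj_point (complexify (\<phi> t))) ` T \<subseteq> common_zeros (CARD('n) - 1) f"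
  proof
    fix P assume "P \<in> (\<lambda>t. proj_point (complexify (\<phi> t))) ` T"
    then obtain t where t: "t \<in> T" "P = proj_point (complexify (\<phi> t))" by blast
    then show "P \<in> common_zeros (CARD('n) - 1) f"
      unfolding common_zeros_def using nz zero
      by (intro CollectI exI[of _ "complexify (\<phi> t)"]) (simp add: eval_poly_complexify)
  qed
  moreover have "finite (common_zeros (CARD('n) - 1) f)"
    using transversal by (simp add: intersect_transversely_def)
  ultimately show False
    using \<open>infinite T\<close> finite_imageD finite_subset by blast
qed

text \<open>\<open>v i\<^sub>0\<close> lies on the curve at infinity and the points of
  \<open>M\<close> at finite parameters, which gives at least \<open>d * e + 1\<close> zeros where
  each \<open>f k\<close> has formal degree \<open>d * e\<close>. \<open>T\<close> collects
  parameters at which the parametrization is nonzero and projectively injective.\<close>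

lemma no_curve_through_points:
  fixes c :: "'n \<Rightarrow> real poly"
  defines "\<phi> \<equiv> \<lambda>t. \<chi> i. poly (c i) t"
  assumes deg: "\<And>i. degree (c i) \<le> e" and "0 < e"
    and lead: "i\<^sub>0 < s" "(\<chi> i. coeff (c i) e) = \<kappa> *\<^sub>R v i\<^sub>0"
    and M: "M \<subseteq> {..<s}" "d * e \<le> card M" "\<And>m. m \<in> M \<Longrightarrow> \<exists>t \<kappa>. \<kappa> \<noteq> 0 \<and> \<phi> t = \<kappa> *\<^sub>R v m"
    and T: "infinite T" "\<And>t. t \<in> T \<Longrightarrow> \<phi> t \<noteq> 0"
      "\<And>t t' c. t \<in> T \<Longrightarrow> t' \<in> T \<Longrightarrow> \<phi> t = c *\<^sub>R \<phi> t' \<Longrightarrow> t = t'"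
  shows False
proof -
  obtain \<tau> \<mu> where \<tau>: "\<And>m. m \<in> M \<Longrightarrow> \<mu> m \<noteq> 0 \<and> \<phi> (\<tau> m) = \<mu> m *\<^sub>R v m"
    using M(3) by metis
  have inj: "inj_on \<tau> M"
  proof (rule inj_onI)
    fix m m' assume mm: "m \<in> M" "m' \<in> M" "\<tau> m = \<tau> m'"
    then have "\<mu> m *\<^sub>R v m = \<mu> m' *\<^sub>R v m'" using \<tau> by metis
    then have "v m = (\<mu> m' / \<mu> m) *\<^sub>R v m'"
      using \<tau>[OF mm(1)]
      by (metis (no_types, lifting) divide_inverse_commute scaleR_scaleR scaleR_one left_inverse)
    then show "m = m'" using v_nonparallel mm M(1) by blast
  qed
  have finM: "finite M" using M(1) finite_subset by blast
  have zero: "eval_poly (f k) (\<phi> t) = 0" if k: "k < CARD('n) - 1" for k t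
    unfolding \<phi>_def
  proof (rule form_vanishes_on_curve[OF f_forms[OF k], where c = c and e = e and T = "\<tau> ` M"])
    show "0 < d * e" using d_pos \<open>0 < e\<close> by simp
    show "eval_poly (f k) (\<chi> i. coeff (c i) e) = 0"
      using f_zero[OF lead(1) k] by (simp add: lead(2) eval_poly_scale_arg[OF f_forms[OF k]]
          flip: scalar_mult_eq_scaleR)
    show "d * e \<le> card (\<tau> ` M)" using card_image[OF inj] M by simp
    fix t assume "t \<in> \<tau> ` M"
    then obtain m where m: "m \<in> M" "\<phi> t = \<mu> m *\<^sub>R v m" using \<tau> by blast
    then have "m < s" using M(1) by blast
    then show "eval_poly (f k) (\<chi> i. poly (c i) t) = 0"
      using f_zero[OF \<open>m < s\<close> k] m(2)
      unfolding \<phi>_def by (simp add: eval_poly_scale_arg[OF f_forms[OF k]] flip: scalar_mult_eq_scaleR)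
  qed (use deg finM in auto)
  show False
    by (rule no_common_curve[where \<phi> = \<phi> and T = T]) (use T zero in blast)+
qed

lemma pair_dependence:
  assumes "i < s" "j < s" "i \<noteq> j" "a *\<^sub>R v i + b *\<^sub>R v j = 0"
  shows "a = 0 \<and> b = 0"
proof -
  have "a = 0"
  proof (rule ccontr)
    assume a: "a \<noteq> 0"
    have "v i = inverse a *\<^sub>R (a *\<^sub>R v i)" using a by simp
    also have "a *\<^sub>R v i = - (b *\<^sub>R v j)" using assms(4) by (simp add: eq_neg_iff_add_eq_0)
    finally have "v i = (- inverse a * b) *\<^sub>R v j" by simp
    then show False using v_nonparallel assms by blast
  qed
  then show ?thesis using assms(4) v_nonzero[OF assms(2)] by simp
qed

text \<open>The pencil \<open>v i + t *\<^sub>R v j\<close> reaches \<open>v j\<close> only at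
  infinity, so \<open>j\<close> is the extra zero beyond the \<open>d\<close> points of
  \<open>M\<close>; \<open>i\<close> itself may belong to \<open>M\<close>.\<close>

lemma no_points_on_line:
  assumes ij: "i < s" "j < s" "i \<noteq> j" and M: "M \<subseteq> {..<s}" "d \<le> card M" "j \<notin> M"
    and line: "\<And>m. m \<in> M \<Longrightarrow> \<exists>\<alpha> \<beta>. v m = \<alpha> *\<^sub>R v i + \<beta> *\<^sub>R v j"
  shows False
proof -
  define c where "c = (\<lambda>k. [:v i $ k, v j $ k:])"
  have \<phi>: "(\<chi> k. poly (c k) t) = v i + t *\<^sub>R v j" for t
    by (simp add: c_def vec_eq_iff)
  note indep = pair_dependence[OF ij]
  show False
  proof (rule no_curve_through_points[where c = c and e = 1 and i\<^sub>0 = j and \<kappa> = 1 and M = M and T = UNIV])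
    fix m assume m: "m \<in> M"
    then obtain \<alpha> \<beta> where ab: "v m = \<alpha> *\<^sub>R v i + \<beta> *\<^sub>R v j" using line by blast
    have "\<alpha> \<noteq> 0"
    proof
      assume "\<alpha> = 0"
      then have "v m = \<beta> *\<^sub>R v j" using ab by simp
      then show False using v_nonparallel[of m j] m M ij(2) by blast
    qed
    then show "\<exists>t \<kappa>. \<kappa> \<noteq> 0 \<and> (\<chi> k. poly (c k) t) = \<kappa> *\<^sub>R v m"
      unfolding \<phi> by (intro exI[of _ "\<beta> / \<alpha>"] exI[of _ "1 / \<alpha>"]) (simp add: ab scaleR_add_right)
  next
    fix t show "(\<chi> k. poly (c k) t) \<noteq> 0" using indep[of 1 t] by (auto simp: \<phi>)
  next
    fix t t' a assume "(\<chi> k. poly (c k) t) = a *\<^sub>R (\<chi> k. poly (c k) t')"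
    then have "(1 - a) *\<^sub>R v i + (t - a * t') *\<^sub>R v j = 0"
      unfolding \<phi> by (simp add: algebra_simps)
    from indep[OF this] show "t = t'" by simp
  qed (use assms in \<open>auto simp: c_def vec_eq_iff infinite_UNIV_char_0\<close>)
qed

text \<open>In the coordinates given by the first three points, the conic through the first five points
  becomes a line after inverting all coordinates, whence the parametrization.\<close>

lemma no_points_on_conic:
  assumes idx: "P < s" "Q < s" "R < s" "X < s" "P \<noteq> Q" "P \<noteq> R" "Q \<noteq> R"
    and indep: "\<And>a b c. a *\<^sub>R v P + b *\<^sub>R v Q + c *\<^sub>R v R = 0 \<Longrightarrow> a = 0 \<and> b = 0 \<and> c = 0"
    and X: "v X = x1 *\<^sub>R v P + x2 *\<^sub>R v Q + x3 *\<^sub>R v R"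
    and nz: "x1 \<noteq> 0" "x2 \<noteq> 0" "x3 \<noteq> 0" "y1 \<noteq> 0" "y2 \<noteq> 0" "y3 \<noteq> 0"
    and ne: "x1 * y2 \<noteq> x2 * y1" "x1 * y3 \<noteq> x3 * y1" "x2 * y3 \<noteq> x3 * y2"
    and M: "M \<subseteq> {..<s}" "P \<notin> M" "Q \<notin> M" "R \<notin> M" "2 * d \<le> card M + 3"
      "\<And>m. m \<in> M \<Longrightarrow> \<exists>z1 z2 z3 A B. v m = z1 *\<^sub>R v P + z2 *\<^sub>R v Q + z3 *\<^sub>R v R \<and>
        z1 \<noteq> 0 \<and> z2 \<noteq> 0 \<and> z3 \<noteq> 0 \<and> B \<noteq> 0 \<and>
        1 / z1 = A / x1 + B / y1 \<and> 1 / z2 = A / x2 + B / y2 \<and> 1 / z3 = A / x3 + B / y3"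
  shows False
proof -
  \<comment> \<open>After inversion of the coordinates, \<open>t\<close> runs through the line
    joining the images of (x1, x2, x3) and (y1, y2, y3). Clearing denominators gives the conic
    \<open>c\<close>, with \<open>X\<close> at t = \<infinity> and (y1, y2, y3) at t = 0.\<close>
  define l1 l2 l3 where "l1 = [:1 / y1, 1 / x1:]" and "l2 = [:1 / y2, 1 / x2:]"
    and "l3 = [:1 / y3, 1 / x3:]"
  note l_defs = l1_def l2_def l3_def
  define c where "c = (\<lambda>k. smult (v P $ k) (l2 * l3) + smult (v Q $ k) (l1 * l3) + smult (v R $ k) (l1 * l2))"
  define \<phi> where "\<phi> t = (\<chi> k. poly (c k) t)" for t
  have \<phi>: "\<phi> t = (poly l2 t * poly l3 t) *\<^sub>R v P + (poly l1 t * poly l3 t) *\<^sub>R v Q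
      + (poly l1 t * poly l2 t) *\<^sub>R v R" for t
    by (simp add: \<phi>_def c_def vec_eq_iff mult_ac)
  \<comment> \<open>Off these roots the coordinates can be inverted back, so the parametrization is
    nonzero and injective there.\<close>
  let ?T = "{t. poly l1 t \<noteq> 0 \<and> poly l2 t \<noteq> 0 \<and> poly l3 t \<noteq> 0}"
  have l0: "l1 \<noteq> 0" "l2 \<noteq> 0" "l3 \<noteq> 0" using nz by (auto simp: l_defs)
  have inf: "infinite ?T"
  proof
    assume "finite ?T"
    then have "finite (?T \<union> {t. poly l1 t = 0} \<union> {t. poly l2 t = 0} \<union> {t. poly l3 t = 0})"
      using l0 poly_roots_finite by blast
    moreover have "?T \<union> {t. poly l1 t = 0} \<union> {t. poly l2 t = 0} \<union> {t. poly l3 t = 0} = UNIV"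
      by blast
    ultimately show False using infinite_UNIV_char_0[where 'a=real] by simp
  qed
  have P: "\<exists>t \<kappa>. \<kappa> \<noteq> 0 \<and> \<phi> t = \<kappa> *\<^sub>R v P"
  proof -
    \<comment> \<open>At the root of \<open>l1\<close> both products containing \<open>l1\<close>
      vanish and only \<open>v P\<close> survives; \<open>ne\<close> keeps the three roots
      distinct.\<close>
    have "poly l1 (- x1 / y1) = 0" "poly l2 (- x1 / y1) \<noteq> 0" "poly l3 (- x1 / y1) \<noteq> 0"
      using nz ne by (auto simp: l_defs divide_simps mult_ac)
    then show ?thesis
      by (intro exI[of _ "- x1 / y1"] exI[of _ "poly l2 (- x1 / y1) * poly l3 (- x1 / y1)"])
        (simp add: \<phi>)
  qed
  have Q: "\<exists>t \<kappa>. \<kappa> \<noteq> 0 \<and> \<phi> t = \<kappa> *\<^sub>R v Q"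
  proof -
    have "poly l2 (- x2 / y2) = 0" "poly l1 (- x2 / y2) \<noteq> 0" "poly l3 (- x2 / y2) \<noteq> 0"
      using nz ne by (auto simp: l_defs divide_simps mult_ac)
    then show ?thesis
      by (intro exI[of _ "- x2 / y2"] exI[of _ "poly l1 (- x2 / y2) * poly l3 (- x2 / y2)"])
        (simp add: \<phi>)
  qed
  have R: "\<exists>t \<kappa>. \<kappa> \<noteq> 0 \<and> \<phi> t = \<kappa> *\<^sub>R v R"
  proof -
    have "poly l3 (- x3 / y3) = 0" "poly l1 (- x3 / y3) \<noteq> 0" "poly l2 (- x3 / y3) \<noteq> 0"
      using nz ne by (auto simp: l_defs divide_simps mult_ac)
    then show ?thesis
      by (intro exI[of _ "- x3 / y3"] exI[of _ "poly l1 (- x3 / y3) * poly l2 (- x3 / y3)"])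
        (simp add: \<phi>)
  qed
  have m: "\<exists>t \<kappa>. \<kappa> \<noteq> 0 \<and> \<phi> t = \<kappa> *\<^sub>R v m" if "m \<in> M" for m
  proof -
    obtain z1 z2 z3 A B where z: "v m = z1 *\<^sub>R v P + z2 *\<^sub>R v Q + z3 *\<^sub>R v R"
      "z1 \<noteq> 0" "z2 \<noteq> 0" "z3 \<noteq> 0" "B \<noteq> 0"
      "1 / z1 = A / x1 + B / y1" "1 / z2 = A / x2 + B / y2" "1 / z3 = A / x3 + B / y3"
      using M(6)[OF \<open>m \<in> M\<close>] by blast
    \<comment> \<open>The weights (A, B) on the inverted line correspond to the parameter
      \<open>A / B\<close>; B = 0 would be the point \<open>X\<close> at infinity.\<close>
    have "poly l1 (A / B) = (A / x1 + B / y1) / B" "poly l2 (A / B) = (A / x2 + B / y2) / B"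
      "poly l3 (A / B) = (A / x3 + B / y3) / B"
      using z(5) by (simp_all add: l_defs add_divide_distrib)
    then have L: "poly l1 (A / B) = 1 / (z1 * B)" "poly l2 (A / B) = 1 / (z2 * B)"
      "poly l3 (A / B) = 1 / (z3 * B)"
      unfolding z(6-8)[symmetric] by simp_all
    have "\<phi> (A / B) = (1 / (z1 * z2 * z3 * B\<^sup>2)) *\<^sub>R v m"
      using z(2-5) by (simp add: \<phi> L z(1) scaleR_add_right power2_eq_square mult_ac)
    then show ?thesis using z(2-5)
      by (intro exI[of _ "A / B"] exI[of _ "1 / (z1 * z2 * z3 * B\<^sup>2)"]) simp
  qed
  have co: "coeff (l2 * l3) 2 = 1 / (x2 * x3)" "coeff (l1 * l3) 2 = 1 / (x1 * x3)"
    "coeff (l1 * l2) 2 = 1 / (x1 * x2)"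
    by (simp_all add: l_defs numeral_2_eq_2)
  have deg: "degree (l2 * l3) \<le> 2" "degree (l1 * l3) \<le> 2" "degree (l1 * l2) \<le> 2"
    by (rule order_trans[OF degree_mult_le], simp add: l_defs)+
  show False
  proof (rule no_curve_through_points[where c = c and e = 2 and i\<^sub>0 = X and \<kappa> = "1 / (x1 * x2 * x3)"
        and M = "insert P (insert Q (insert R M))" and T = ?T])
    show "degree (c k) \<le> 2" for k
      unfolding c_def
      by (intro degree_add_le order_trans[OF degree_smult_le] deg)
    show "(\<chi> k. coeff (c k) 2) = (1 / (x1 * x2 * x3)) *\<^sub>R v X"
      using nz by (simp add: c_def co X vec_eq_iff divide_simps algebra_simps)
    show "d * 2 \<le> card (insert P (insert Q (insert R M)))"
      using M idx finite_subset[OF M(1)] by simp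
    show "\<exists>t \<kappa>. \<kappa> \<noteq> 0 \<and> (\<chi> k. poly (c k) t) = \<kappa> *\<^sub>R v m" if "m \<in> insert P (insert Q (insert R M))" for m
      using that P Q R m unfolding \<phi>_def by blast
    show "infinite ?T" by (rule inf)
    show "(\<chi> k. poly (c k) t) \<noteq> 0" if t: "t \<in> ?T" for t
      using indep[of "poly l2 t * poly l3 t" "poly l1 t * poly l3 t" "poly l1 t * poly l2 t"] t
      unfolding \<phi>_def[symmetric] \<phi> by auto
    show "t = t'" if t: "t \<in> ?T" "t' \<in> ?T" and eq: "(\<chi> k. poly (c k) t) = a *\<^sub>R (\<chi> k. poly (c k) t')" for t t' a
    proof -
      have "(poly l2 t * poly l3 t - a * (poly l2 t' * poly l3 t')) *\<^sub>R v P
        + (poly l1 t * poly l3 t - a * (poly l1 t' * poly l3 t')) *\<^sub>R v Q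
        + (poly l1 t * poly l2 t - a * (poly l1 t' * poly l2 t')) *\<^sub>R v R = 0"
        using eq unfolding \<phi>_def[symmetric] \<phi> by (simp add: algebra_simps)
      from indep[OF this] have e: "poly l2 t * poly l3 t = a * (poly l2 t' * poly l3 t')"
        "poly l1 t * poly l3 t = a * (poly l1 t' * poly l3 t')" by auto
      have "poly l2 t * poly l3 t * (a * (poly l1 t' * poly l3 t')) = poly l1 t * poly l3 t * (a * (poly l2 t' * poly l3 t'))"
        using e by simp
      moreover have "a \<noteq> 0" using e t by auto
      ultimately have "poly l2 t * poly l1 t' = poly l1 t * poly l2 t'"
        using t by (simp add: mult_ac)
      \<comment> \<open>The ratio of \<open>l2\<close> and \<open>l1\<close> is a fractional linear
        function of \<open>t\<close>, injective because its determinant, the second factor, is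
        nonzero.\<close>
      then have "(t - t') * (1 / (x2 * y1) - 1 / (x1 * y2)) = 0"
        by (simp add: l_defs algebra_simps add_divide_distrib diff_divide_distrib)
      moreover have "1 / (x2 * y1) - 1 / (x1 * y2) \<noteq> 0"
        using nz ne by (simp add: divide_simps)
      ultimately show ?thesis by simp
    qed
  qed (use idx M in auto)
qed

end

subsection \<open>Hyperplanes\<close>

lemma hyperplane_through:
  fixes S :: "(real ^ 'n::finite) set"
  assumes "finite S" "card S < CARD('n)"
  obtains a where "a \<noteq> 0" "\<And>x. x \<in> S \<Longrightarrow> a \<bullet> x = 0"
proof -
  have "dim S < DIM(real ^ 'n)"
    using dim_le_card'[OF assms(1)] assms(2) by simp
  then obtain a where "a \<noteq> 0" "\<And>y. y \<in> span S \<Longrightarrow> orthogonal a y"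
    using orthogonal_to_subspace_exists by blast
  then show ?thesis
    using that by (simp add: orthogonal_def span_base)
qed

lemma inner_span_eq_0:
  assumes "\<And>y. y \<in> S \<Longrightarrow> a \<bullet> y = 0" "x \<in> span S" shows "a \<bullet> x = 0"
proof -
  have "span S \<subseteq> {x. a \<bullet> x = 0}"
    by (rule span_minimal) (use assms(1) subspace_hyperplane in auto)
  then show ?thesis using assms(2) by blast
qed

text \<open>\<open>S\<close> together with its normal \<open>a\<close> is a basis by count; the
  component of \<open>x\<close> along \<open>a\<close> is detected by the inner product with
  \<open>a\<close> and is zero.\<close>

lemma hyperplane_subset_span:
  fixes S :: "(real ^ 'n::finite) set"
  assumes S: "independent S" "card S = CARD('n) - 1"
    and a: "a \<noteq> 0" "\<And>y. y \<in> S \<Longrightarrow> a \<bullet> y = 0" and x: "a \<bullet> x = 0"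
  shows "x \<in> span S"
proof -
  have "a \<notin> span S"
    using inner_span_eq_0[of S a a] a by auto
  then have ind: "independent (insert a S)" and "a \<notin> S"
    using S(1) by (auto simp: independent_insert span_base)
  moreover have "finite S" using S(1) independent_bound by blast
  moreover have "0 < CARD('n)" by (simp add: card_gt_0_iff)
  ultimately have "card (insert a S) = CARD('n)"
    using S(2) by simp
  then have "UNIV \<subseteq> span (insert a S)"
    using card_ge_dim_independent[of "insert a S" UNIV] ind by simp
  then have "x \<in> span (insert a S)" by blast
  then obtain k where k: "x - k *\<^sub>R a \<in> span S"
    unfolding span_breakdown_eq by blast
  then have "a \<bullet> (x - k *\<^sub>R a) = 0"
    using inner_span_eq_0 a(2) by blast
  then have "k = 0" using a(1) x by (simp add: inner_diff_right)
  then show ?thesis using k by simp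
qed

lemma hyperplane_unique:
  fixes S :: "(real ^ 'n::finite) set"
  assumes "independent S" "card S = CARD('n) - 1"
    and "a \<noteq> 0" "\<And>y. y \<in> S \<Longrightarrow> a \<bullet> y = 0" "\<And>y. y \<in> S \<Longrightarrow> b \<bullet> y = 0" and "a \<bullet> x = 0"
  shows "b \<bullet> x = 0"
  using hyperplane_subset_span[of S a x] inner_span_eq_0[of S b x] assms by blast

section \<open>Hyperplanes through the points and weighted relations on quadrics\<close>

context point_configuration
begin

definition on_hyperplane :: "nat set \<Rightarrow> bool" where
  "on_hyperplane M \<longleftrightarrow> (\<exists>a. a \<noteq> 0 \<and> (\<forall>m\<in>M. a \<bullet> v m = 0))"

text \<open>The polarized form of \<Sum> w m * v m \<otimes> v m = 0: fixing one of the two linear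
  factors contracts the tensor to a linear relation among the \<open>v m\<close>.\<close>

definition quadric_relation :: "(nat \<Rightarrow> real) \<Rightarrow> bool" where
  "quadric_relation w \<longleftrightarrow> (\<forall>a b. (\<Sum>m<s. w m * (a \<bullet> v m) * (b \<bullet> v m)) = 0)"

lemma on_hyperplane_mono: "on_hyperplane B \<Longrightarrow> A \<subseteq> B \<Longrightarrow> on_hyperplane A"
  unfolding on_hyperplane_def by blast

lemma on_hyperplane_span:
  assumes "finite M" "card M < CARD('n)" "v i \<in> span (v ` M)"
  shows "on_hyperplane (insert i M)"
proof -
  have "card (v ` M) < CARD('n)"
    using card_image_le[OF assms(1), of v] assms(2) by linarith
  then obtain a where "a \<noteq> 0" "\<And>x. x \<in> v ` M \<Longrightarrow> a \<bullet> x = 0"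
    using hyperplane_through[of "v ` M"] assms(1) by blast
  then show ?thesis
    unfolding on_hyperplane_def using inner_span_eq_0[OF _ assms(3), of a] by blast
qed

text \<open>\<open>CARD('n) - 1\<close> independent points determine their hyperplane, so two
  hyperplanes that share them coincide.\<close>

lemma on_hyperplane_Un:
  assumes K: "independent (v ` K)" "card (v ` K) = CARD('n) - 1"
    and sub: "K \<subseteq> A" "K \<subseteq> B" and AB: "on_hyperplane A" "on_hyperplane B"
  shows "on_hyperplane (A \<union> B)"
proof -
  obtain a b where a: "a \<noteq> 0" "\<forall>m\<in>A. a \<bullet> v m = 0" and b: "b \<noteq> 0" "\<forall>m\<in>B. b \<bullet> v m = 0"
    using AB unfolding on_hyperplane_def by blast
  have "a \<bullet> v m = 0" if "m \<in> B" for m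
    by (rule hyperplane_unique[OF K b(1)]) (use a b sub that in auto)
  then show ?thesis
    unfolding on_hyperplane_def using a by blast
qed

text \<open>If a hyperplane through \<open>T\<close> misses \<open>v i\<close>, contracting the
  relation with its normal erases \<open>T\<close> and leaves \<open>v i\<close> as a combination of
  the vectors in \<open>T'\<close>. Fewer than \<open>CARD('n)\<close> points always fit on a
  hyperplane, so \<open>i\<close> joins one of the two sets.\<close>

lemma quadric_relation_split:
  assumes w: "quadric_relation w" and i: "i < s" "w i \<noteq> 0"
    and supp: "\<And>m. m < s \<Longrightarrow> m \<notin> insert i (T \<union> T') \<Longrightarrow> w m = 0"
    and T: "finite T" "card T < CARD('n)" and T': "finite T'" "card T' < CARD('n)"
  shows "on_hyperplane (insert i T) \<or> on_hyperplane (insert i T')"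
proof -
  have "card (v ` T) < CARD('n)"
    using card_image_le[OF T(1), of v] T(2) by linarith
  then obtain a where a: "a \<noteq> 0" "\<And>x. x \<in> v ` T \<Longrightarrow> a \<bullet> x = 0"
    using hyperplane_through[of "v ` T"] T(1) by blast
  show ?thesis
  proof (cases "a \<bullet> v i = 0")
    case True
    then show ?thesis unfolding on_hyperplane_def using a by blast
  next
    case False
    let ?x = "\<Sum>m<s. (w m * (a \<bullet> v m)) *\<^sub>R v m"
    have "b \<bullet> ?x = 0" for b
      using w unfolding quadric_relation_def by (simp add: inner_sum_right)
    then have "?x = 0" using inner_eq_zero_iff by blast
    then have "(w i * (a \<bullet> v i)) *\<^sub>R v i = - (\<Sum>m\<in>{..<s} - {i}. (w m * (a \<bullet> v m)) *\<^sub>R v m)"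
      using sum.remove[of "{..<s}" i "\<lambda>m. (w m * (a \<bullet> v m)) *\<^sub>R v m"] i(1)
      by (simp add: eq_neg_iff_add_eq_0)
    also have "\<dots> \<in> span (v ` T')"
    proof (intro span_neg span_sum)
      fix m assume m: "m \<in> {..<s} - {i}"
      show "(w m * (a \<bullet> v m)) *\<^sub>R v m \<in> span (v ` T')"
      proof (cases "m \<in> T'")
        case True then show ?thesis by (simp add: span_base span_scale)
      next
        case False
        then have "w m * (a \<bullet> v m) = 0" using supp[of m] a(2) m by auto
        then show ?thesis by (auto simp: span_zero)
      qed
    qed
    finally have "inverse (w i * (a \<bullet> v i)) *\<^sub>R ((w i * (a \<bullet> v i)) *\<^sub>R v i) \<in> span (v ` T')"
      by (rule span_scale)
    moreover have "inverse (w i * (a \<bullet> v i)) * (w i * (a \<bullet> v i)) = 1"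
      using False i(2) by (intro left_inverse) simp
    ultimately have "v i \<in> span (v ` T')" by (simp only: scaleR_scaleR scaleR_one)
    then show ?thesis using on_hyperplane_span T' by blast
  qed
qed

lemma independent_pair:
  assumes "i < s" "j < s" "i \<noteq> j"
  shows "independent (v ` {i, j})" "card (v ` {i, j}) = 2"
proof -
  have "v i \<notin> span {v j}"
    using v_nonparallel[OF assms(1,2)] assms(3) by (auto simp: span_singleton)
  then have "v i \<noteq> v j" using span_base by fastforce
  then show "card (v ` {i, j}) = 2" by simp
  show "independent (v ` {i, j})"
    using \<open>v i \<notin> span {v j}\<close> v_nonzero[OF assms(2)] by (simp add: independent_insert)
qed

lemma independent_triple:
  assumes "\<And>a b c. a *\<^sub>R v i + b *\<^sub>R v j + c *\<^sub>R v k = 0 \<Longrightarrow> a = 0 \<and> b = 0 \<and> c = 0"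
    and "j < s" "k < s" "j \<noteq> k"
  shows "independent (v ` {i, j, k})" "card (v ` {i, j, k}) = 3"
proof -
  have *: "v i \<notin> span (v ` {j, k})"
  proof
    assume "v i \<in> span (v ` {j, k})"
    then obtain b c where "v i - b *\<^sub>R v j = c *\<^sub>R v k"
      by (auto simp: span_breakdown_eq)
    then have "1 *\<^sub>R v i + (- b) *\<^sub>R v j + (- c) *\<^sub>R v k = 0"
      by simp
    from assms(1)[OF this] show False by simp
  qed
  then have "v i \<notin> v ` {j, k}" using span_superset[of "v ` {j, k}"] by blast
  then show "independent (v ` {i, j, k})" "card (v ` {i, j, k}) = 3"
    using * independent_pair[OF assms(2-4)] by (simp_all add: independent_insert)
qed

end

subsection \<open>The Cayley-Bacharach property\<close>

context point_configuration
begin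

definition forms_relation :: "(nat \<Rightarrow> real) \<Rightarrow> bool" where
  "forms_relation w \<longleftrightarrow> (\<forall>p\<in>forms d. (\<Sum>m<s. w m * eval_poly p (v m)) = 0)"

section \<open>Quadrics in four variables\<close>

lemma triple_independent_quadrics:
  assumes d: "d = 2" and ijk: "i < s" "j < s" "k < s" "i \<noteq> j" "i \<noteq> k" "j \<noteq> k"
    and rel: "a *\<^sub>R v i + b *\<^sub>R v j + c *\<^sub>R v k = 0"
  shows "a = 0 \<and> b = 0 \<and> c = 0"
proof -
  have "c = 0"
  proof (rule ccontr)
    assume c: "c \<noteq> 0"
    have "v k = inverse c *\<^sub>R (c *\<^sub>R v k)" using c by simp
    also have "c *\<^sub>R v k = - (a *\<^sub>R v i) - b *\<^sub>R v j"
      using rel by (simp add: algebra_simps eq_neg_iff_add_eq_0)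
    finally have "v k = (- inverse c * a) *\<^sub>R v i + (- inverse c * b) *\<^sub>R v j"
      by (simp add: algebra_simps)
    moreover have "v i = 1 *\<^sub>R v i + 0 *\<^sub>R v j" by simp
    ultimately have "\<exists>\<alpha> \<beta>. v m = \<alpha> *\<^sub>R v i + \<beta> *\<^sub>R v j" if "m \<in> {i, k}" for m
      using that by blast
    then show False
      using no_points_on_line[of i j "{i, k}"] ijk d by simp
  qed
  then show ?thesis using pair_dependence[of i j a b] rel ijk by simp
qed

text \<open>No three of the points are collinear, so five coplanar ones lie on a conic with the
  parametrization above. Five zeros are one more than \<open>2 * d = 4\<close>, so every
  \<open>f k\<close> would contain the conic.\<close>

lemma no_five_coplanar_quadrics:
  assumes d: "d = 2" and n: "CARD('n) = 4"
    and idx: "{P, Q, R, X, Y} \<subseteq> {..<s}" "distinct [P, Q, R, X, Y]"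
    and cop: "on_hyperplane {P, Q, R, X, Y}"
  shows False
proof -
  have lt: "P < s" "Q < s" "R < s" "X < s" "Y < s" using idx(1) by auto
  obtain a where a: "a \<noteq> 0" "\<forall>m\<in>{P, Q, R, X, Y}. a \<bullet> v m = 0"
    using cop unfolding on_hyperplane_def by blast
  note t = triple_independent_quadrics[OF d]
  have PQR: "\<And>a b c. a *\<^sub>R v P + b *\<^sub>R v Q + c *\<^sub>R v R = 0 \<Longrightarrow> a = 0 \<and> b = 0 \<and> c = 0"
    using t[of P Q R] lt idx(2) by simp
  have S: "independent (v ` {P, Q, R})" "card (v ` {P, Q, R}) = CARD('n) - 1"
    using independent_triple[OF PQR] lt idx(2) n by simp_all
  have coord: "\<exists>x1 x2 x3. v m = x1 *\<^sub>R v P + x2 *\<^sub>R v Q + x3 *\<^sub>R v R"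
    if "m \<in> {P, Q, R, X, Y}" for m
  proof -
    have "v m \<in> span (v ` {P, Q, R})"
      by (rule hyperplane_subset_span[OF S a(1)]) (use a that in auto)
    then obtain x1 x2 x3 where "v m - x1 *\<^sub>R v P - x2 *\<^sub>R v Q = x3 *\<^sub>R v R"
      by (auto simp: span_breakdown_eq)
    then have "v m = x1 *\<^sub>R v P + x2 *\<^sub>R v Q + x3 *\<^sub>R v R"
      by (simp add: algebra_simps)
    then show ?thesis by blast
  qed
  obtain x1 x2 x3 where X: "v X = x1 *\<^sub>R v P + x2 *\<^sub>R v Q + x3 *\<^sub>R v R" using coord[of X] by blast
  obtain y1 y2 y3 where Y: "v Y = y1 *\<^sub>R v P + y2 *\<^sub>R v Q + y3 *\<^sub>R v R" using coord[of Y] by blast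
  \<comment> \<open>A vanishing coordinate would make \<open>m\<close> collinear with two of
    \<open>P\<close>, \<open>Q\<close>, \<open>R\<close>.\<close>
  have nz: "z1 \<noteq> 0 \<and> z2 \<noteq> 0 \<and> z3 \<noteq> 0"
    if z: "v m = z1 *\<^sub>R v P + z2 *\<^sub>R v Q + z3 *\<^sub>R v R" and m: "m \<in> {X, Y}" for m z1 z2 z3
  proof -
    have m': "m < s" "m \<noteq> P" "m \<noteq> Q" "m \<noteq> R" using m lt idx(2) by auto
    have ne: "P \<noteq> Q" "P \<noteq> R" "Q \<noteq> R" using idx(2) by auto
    have "z1 \<noteq> 0"
    proof
      assume "z1 = 0"
      then have "(-1) *\<^sub>R v m + z2 *\<^sub>R v Q + z3 *\<^sub>R v R = 0" using z by simp
      from t[OF m'(1) lt(2,3) m'(3,4) ne(3) this] show False by simp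
    qed
    moreover have "z2 \<noteq> 0"
    proof
      assume "z2 = 0"
      then have "(-1) *\<^sub>R v m + z1 *\<^sub>R v P + z3 *\<^sub>R v R = 0" using z by simp
      from t[OF m'(1) lt(1,3) m'(2,4) ne(2) this] show False by simp
    qed
    moreover have "z3 \<noteq> 0"
    proof
      assume "z3 = 0"
      then have "(-1) *\<^sub>R v m + z1 *\<^sub>R v P + z2 *\<^sub>R v Q = 0" using z by simp
      from t[OF m'(1) lt(1,2) m'(2,3) ne(1) this] show False by simp
    qed
    ultimately show ?thesis by blast
  qed
  have nx: "x1 \<noteq> 0" "x2 \<noteq> 0" "x3 \<noteq> 0" and ny: "y1 \<noteq> 0" "y2 \<noteq> 0" "y3 \<noteq> 0"
    using nz[OF X] nz[OF Y] by auto
  \<comment> \<open>Each combination eliminates the coordinate along \<open>P\<close> or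
    \<open>Q\<close>; if a 2 by 2 minor vanishes as well, \<open>X\<close>, \<open>Y\<close> and the
    one remaining base point are collinear.\<close>
  have "y1 *\<^sub>R v X = x1 *\<^sub>R v Y + (x2 * y1 - x1 * y2) *\<^sub>R v Q + (x3 * y1 - x1 * y3) *\<^sub>R v R"
    "y2 *\<^sub>R v X = x2 *\<^sub>R v Y + (x1 * y2 - x2 * y1) *\<^sub>R v P + (x3 * y2 - x2 * y3) *\<^sub>R v R"
    unfolding X Y by (simp_all add: scaleR_add_right scaleR_diff_left mult.commute)
  then have "x1 * y2 = x2 * y1 \<Longrightarrow> y1 *\<^sub>R v X + (- x1) *\<^sub>R v Y + (x1 * y3 - x3 * y1) *\<^sub>R v R = 0"
    "x1 * y3 = x3 * y1 \<Longrightarrow> y1 *\<^sub>R v X + (- x1) *\<^sub>R v Y + (x1 * y2 - x2 * y1) *\<^sub>R v Q = 0"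
    "x2 * y3 = x3 * y2 \<Longrightarrow> y2 *\<^sub>R v X + (- x2) *\<^sub>R v Y + (x2 * y1 - x1 * y2) *\<^sub>R v P = 0"
    by (simp_all add: scaleR_diff_left)
  then have ne: "x1 * y2 \<noteq> x2 * y1" "x1 * y3 \<noteq> x3 * y1" "x2 * y3 \<noteq> x3 * y2"
    using t[of X Y R y1 "- x1"] t[of X Y Q y1 "- x1"] t[of X Y P y2 "- x2"] lt idx(2) ny by auto
  show False
  proof (rule no_points_on_conic[where M = "{Y}", OF lt(1-4) _ _ _ PQR X nx ny ne])
    fix m assume "m \<in> {Y}"
    then show "\<exists>z1 z2 z3 A B. v m = z1 *\<^sub>R v P + z2 *\<^sub>R v Q + z3 *\<^sub>R v R \<and>
        z1 \<noteq> 0 \<and> z2 \<noteq> 0 \<and> z3 \<noteq> 0 \<and> B \<noteq> 0 \<and>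
        1 / z1 = A / x1 + B / y1 \<and> 1 / z2 = A / x2 + B / y2 \<and> 1 / z3 = A / x3 + B / y3"
      using Y ny by (intro exI[of _ y1] exI[of _ y2] exI[of _ y3] exI[of _ 0] exI[of _ 1]) simp
  qed (use lt idx(2) d in auto)
qed

text \<open>If \<open>w j = 0\<close>, the support is \<open>i\<close> and at most six further
  points. Every halving of the six puts \<open>i\<close> and one half on a plane; two such planes
  that share \<open>i\<close> and two further points coincide and carry five of the points.\<close>

lemma quadrics_full_support:
  assumes d: "d = 2" and n: "CARD('n) = 4" and s: "s = 8" and w: "quadric_relation w"
    and ij: "i < s" "j < s" "w i \<noteq> 0"
  shows "w j \<noteq> 0"
proof
  assume wj: "w j = 0"
  have "card ({..<s} - {i, j}) = 6"
  proof -
    have "i \<noteq> j" using ij(3) wj by auto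
    then show ?thesis using ij s by (subst card_Diff_subset) auto
  qed
  then obtain xs where xs: "set xs = {..<s} - {i, j}" "distinct xs" "length xs = 6"
    using finite_distinct_list[of "{..<s} - {i, j}"] distinct_card by force
  then obtain a b c e g h where abc: "xs = [a, b, c, e, g, h]"
    by (auto simp: eval_nat_numeral length_Suc_conv)
  have lt: "a < s" "b < s" "c < s" "e < s" "g < s" "h < s"
    and ne: "distinct [i, a, b, c, e, g, h]"
    using xs abc by auto
  have supp: "m \<in> {i, a, b, c, e, g, h}" if "m < s" "w m \<noteq> 0" for m
    using that wj xs(1) abc by auto
  have split: "on_hyperplane (insert i T) \<or> on_hyperplane (insert i T')"
    if "T \<union> T' = {a, b, c, e, g, h}" "finite T" "finite T'" "card T = 3" "card T' = 3" for T T'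
  proof (rule quadric_relation_split[OF w ij(1,3)])
    show "w m = 0" if "m < s" "m \<notin> insert i (T \<union> T')" for m
      using supp[of m] that unfolding \<open>T \<union> T' = {a, b, c, e, g, h}\<close> by blast
  qed (use that n in simp_all)
  have no: False
    if AB: "on_hyperplane A" "on_hyperplane B" and K: "{i, k, l} \<subseteq> A" "{i, k, l} \<subseteq> B" "distinct [i, k, l, p, q]"
      "{k, l, p, q} \<subseteq> {..<s}" "{p, q} \<subseteq> A \<union> B" for A B k l p q
  proof -
    have "independent (v ` {i, k, l})" "card (v ` {i, k, l}) = CARD('n) - 1"
      using independent_triple[OF triple_independent_quadrics[OF d, of i k l]] K ij n by auto
    then have "on_hyperplane (A \<union> B)" using on_hyperplane_Un AB K by blast
    then have "on_hyperplane {i, k, l, p, q}"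
      by (rule on_hyperplane_mono) (use K in auto)
    then show False
      using no_five_coplanar_quadrics[OF d n, of i k l p q] K ij by simp
  qed
  \<comment> \<open>Three halvings suffice: of the halves they select, two lie within
    \<open>{a, b, c, e}\<close> or two contain \<open>{g, h}\<close>, and such a pair shares two
    points besides \<open>i\<close>.\<close>
  have 1: "on_hyperplane (insert i {a, b, c}) \<or> on_hyperplane (insert i {e, g, h})"
    by (rule split) (use ne in auto)
  have 2: "on_hyperplane (insert i {a, b, e}) \<or> on_hyperplane (insert i {c, g, h})"
    by (rule split) (use ne in auto)
  have 3: "on_hyperplane (insert i {a, c, e}) \<or> on_hyperplane (insert i {b, g, h})"
    by (rule split) (use ne in auto)
  have "\<not> (on_hyperplane (insert i {a, b, c}) \<and> on_hyperplane (insert i {a, b, e}))"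
    using no[of _ _ a b c e] ne lt by auto
  moreover have "\<not> (on_hyperplane (insert i {a, b, c}) \<and> on_hyperplane (insert i {a, c, e}))"
    using no[of _ _ a c b e] ne lt by auto
  moreover have "\<not> (on_hyperplane (insert i {c, g, h}) \<and> on_hyperplane (insert i {b, g, h}))"
    using no[of _ _ g h b c] ne lt by auto
  moreover have "\<not> (on_hyperplane (insert i {e, g, h}) \<and> on_hyperplane (insert i {c, g, h}))"
    using no[of _ _ g h e c] ne lt by auto
  moreover have "\<not> (on_hyperplane (insert i {a, b, e}) \<and> on_hyperplane (insert i {a, c, e}))"
    using no[of _ _ a e b c] ne lt by auto
  moreover have "\<not> (on_hyperplane (insert i {e, g, h}) \<and> on_hyperplane (insert i {b, g, h}))"
    using no[of _ _ g h e b] ne lt by auto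
  ultimately show False using 1 2 3 by blast
qed

lemma forms_relation_quadric:
  assumes "d = 2" "forms_relation w" shows "quadric_relation w"
proof -
  have "linear_form a * linear_form b \<in> forms d" for a b :: "real ^ 'n"
    using forms_mult[OF linear_form_forms linear_form_forms, of a b] assms(1) by (simp add: numeral_2_eq_2)
  then show ?thesis
    using assms(2) unfolding forms_relation_def quadric_relation_def by (fastforce simp: mult.assoc)
qed

section \<open>Cubics in three variables\<close>

lemma no_four_collinear_cubics:
  assumes d: "d = 3" and n: "CARD('n) = 3"
    and idx: "{i, j, k, l} \<subseteq> {..<s}" "distinct [i, j, k, l]" and cop: "on_hyperplane {i, j, k, l}"
  shows False
proof -
  obtain a where a: "a \<noteq> 0" "\<forall>m\<in>{i, j, k, l}. a \<bullet> v m = 0"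
    using cop unfolding on_hyperplane_def by blast
  have S: "independent (v ` {i, j})" "card (v ` {i, j}) = CARD('n) - 1"
    using independent_pair[of i j] idx n by simp_all
  have "\<exists>\<alpha> \<beta>. v m = \<alpha> *\<^sub>R v i + \<beta> *\<^sub>R v j" if "m \<in> {i, k, l}" for m
  proof -
    have "v m \<in> span (v ` {i, j})"
      by (rule hyperplane_subset_span[OF S a(1)]) (use a that in auto)
    then obtain \<alpha> \<beta> where "v m - \<alpha> *\<^sub>R v i = \<beta> *\<^sub>R v j"
      by (auto simp: span_breakdown_eq)
    then have "v m = \<alpha> *\<^sub>R v i + \<beta> *\<^sub>R v j"
      by (simp add: algebra_simps)
    then show ?thesis by blast
  qed
  then show False
    using no_points_on_line[of i j "{i, k, l}"] idx d by simp
qed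

text \<open>Five points with no four collinear impose independent conditions on conics. A point
  \<open>i\<close> of the support would be collinear with one of the pairs \<open>{a, b}\<close>,
  \<open>{c, e}\<close> and with one of \<open>{a, c}\<close>, \<open>{b, e}\<close>; pairs from the
  two lists always share a point, so the two lines coincide and hold four points.\<close>

lemma quadric_relation_five_points:
  assumes d: "d = 3" and n: "CARD('n) = 3" and s: "5 \<le> s" and w: "quadric_relation w"
    and Y: "Y \<subseteq> {..<s}" "card Y \<le> 5" "\<And>m. m < s \<Longrightarrow> m \<notin> Y \<Longrightarrow> w m = 0" and i: "i < s"
  shows "w i = 0"
proof (rule ccontr)
  assume wi: "w i \<noteq> 0"
  \<comment> \<open>Padding to exactly five points leaves four besides \<open>i\<close>, to be split
    into two pairs.\<close>
  obtain Z where Z: "Y \<subseteq> Z" "Z \<subseteq> {..<s}" "card Z = 5"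
    using exists_subset_between[of Y 5 "{..<s}"] Y s by auto
  have iZ: "i \<in> Z" using Y(3)[OF i] wi Z(1) by auto
  have finZ: "finite Z" using Z(2) finite_subset by blast
  then have "card (Z - {i}) = 4" using Z(3) iZ by simp
  then obtain xs where xs: "set xs = Z - {i}" "distinct xs" "length xs = 4"
    using finite_distinct_list[of "Z - {i}"] finZ distinct_card by force
  then obtain a b c e where abc: "xs = [a, b, c, e]"
    by (auto simp: eval_nat_numeral length_Suc_conv)
  have lt: "a < s" "b < s" "c < s" "e < s" and ne: "distinct [i, a, b, c, e]"
    using xs abc Z(2) by auto
  have supp: "m \<in> {i, a, b, c, e}" if "m < s" "w m \<noteq> 0" for m
    using that Y(3)[of m] Z(1) xs(1) abc by auto
  have split: "on_hyperplane (insert i T) \<or> on_hyperplane (insert i T')"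
    if "T \<union> T' = {a, b, c, e}" "finite T" "finite T'" "card T = 2" "card T' = 2" for T T'
  proof (rule quadric_relation_split[OF w i wi])
    show "w m = 0" if "m < s" "m \<notin> insert i (T \<union> T')" for m
      using supp[of m] that unfolding \<open>T \<union> T' = {a, b, c, e}\<close> by blast
  qed (use that n in simp_all)
  have no: False
    if AB: "on_hyperplane A" "on_hyperplane B" and K: "{i, k} \<subseteq> A" "{i, k} \<subseteq> B" "distinct [i, k, p, q]"
      "{k, p, q} \<subseteq> {..<s}" "{p, q} \<subseteq> A \<union> B" for A B k p q
  proof -
    have "independent (v ` {i, k})" "card (v ` {i, k}) = CARD('n) - 1"
      using independent_pair[of i k] K i n by auto
    then have "on_hyperplane (A \<union> B)" using on_hyperplane_Un AB K by blast
    then have "on_hyperplane {i, k, p, q}"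
      by (rule on_hyperplane_mono) (use K in auto)
    then show False
      using no_four_collinear_cubics[OF d n, of i k p q] K i by simp
  qed
  have 1: "on_hyperplane (insert i {a, b}) \<or> on_hyperplane (insert i {c, e})"
    by (rule split) (use ne in auto)
  have 2: "on_hyperplane (insert i {a, c}) \<or> on_hyperplane (insert i {b, e})"
    by (rule split) (use ne in auto)
  have "\<not> (on_hyperplane (insert i {a, b}) \<and> on_hyperplane (insert i {a, c}))"
    using no[of _ _ a b c] ne lt by auto
  moreover have "\<not> (on_hyperplane (insert i {a, b}) \<and> on_hyperplane (insert i {b, e}))"
    using no[of _ _ b a e] ne lt by auto
  moreover have "\<not> (on_hyperplane (insert i {c, e}) \<and> on_hyperplane (insert i {a, c}))"
    using no[of _ _ c e a] ne lt by auto
  moreover have "\<not> (on_hyperplane (insert i {c, e}) \<and> on_hyperplane (insert i {b, e}))"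
    using no[of _ _ e c b] ne lt by auto
  ultimately show False using 1 2 by blast
qed

lemma hyperplane_through_two:
  assumes n: "CARD('n) = 3"
  obtains a where "a \<noteq> 0" "a \<bullet> v p = 0" "a \<bullet> v q = 0"
proof -
  have fin: "finite {v p, v q}" by simp
  have card: "card {v p, v q} < CARD('n)"
    using card_insert_le_m1[of 2 "{v q}" "v p"] n by simp
  show ?thesis
  proof (rule hyperplane_through[OF fin card])
    fix a assume "a \<noteq> 0" "\<And>x. x \<in> {v p, v q} \<Longrightarrow> a \<bullet> x = 0"
    then show ?thesis by (intro that[of a]) auto
  qed
qed

text \<open>The linear factor is absorbed into the weights, and every point on the line of
  \<open>c\<close> drops out of the support.\<close>

lemma forms_relation_quadric_cubics:
  assumes "d = 3" "forms_relation w" shows "quadric_relation (\<lambda>m. w m * (c \<bullet> v m))"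
proof -
  have "linear_form a * linear_form b * linear_form c \<in> forms d" for a b :: "real ^ 'n"
    using forms_mult[OF forms_mult[OF linear_form_forms linear_form_forms] linear_form_forms, of a b c] assms(1)
    by (simp add: numeral_3_eq_3)
  from assms(2)[unfolded forms_relation_def, rule_format, OF this] show ?thesis
    unfolding quadric_relation_def by (simp add: mult_ac)
qed

text \<open>The linear form of the common line removes three of the eight points, and the remaining
  five cannot carry a relation, so they have weight 0. Lines that meet the three points in only one
  of them then show that the three weights vanish too.\<close>

lemma cubics_no_three_collinear:
  assumes d: "d = 3" and n: "CARD('n) = 3" and s: "s = 9" and u: "forms_relation u"
    and ij: "i < s" "j < s" "u i \<noteq> 0" "u j = 0"
    and pqr: "{p, q, r} \<subseteq> {..<s} - {j}" "distinct [p, q, r]" and cop: "on_hyperplane {p, q, r}"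
  shows False
proof -
  let ?Y = "{..<s} - {j}"
  note five = quadric_relation_five_points[OF d n _ forms_relation_quadric_cubics[OF d u]]
  have cY: "card ?Y = 8" using s ij(2) by simp
  have out: "u m = 0" if m: "m \<in> ?Y - {p, q, r}" for m
  proof -
    obtain a where a: "a \<noteq> 0" "\<forall>m\<in>{p, q, r}. a \<bullet> v m = 0"
      using cop unfolding on_hyperplane_def by blast
    have "u m * (a \<bullet> v m) = 0"
    proof (rule five[where Y = "?Y - {p, q, r}"])
      have "card {p, q, r} = 3" using pqr(2) by simp
      then show "card (?Y - {p, q, r}) \<le> 5"
        using cY pqr(1) by (subst card_Diff_subset) auto
    qed (use s m a ij in auto)
    moreover have "a \<bullet> v m \<noteq> 0"
    proof
      assume "a \<bullet> v m = 0"
      then have "on_hyperplane {p, q, r, m}"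
        unfolding on_hyperplane_def using a by blast
      then show False
        using no_four_collinear_cubics[OF d n, of p q r m] pqr m by auto
    qed
    ultimately show ?thesis by simp
  qed
  have "card (?Y - {p, q, r}) \<noteq> 0"
    using cY card_Diff_subset[of "{p, q, r}" ?Y] pqr by auto
  then obtain m where m: "m \<in> ?Y - {p, q, r}" by (metis card.empty equals0I)
  \<comment> \<open>The line through \<open>b\<close> and the outside point \<open>m\<close> differs
    from the common line and misses \<open>a\<close>; multiplied by its linear form, the relation
    involves at most \<open>a\<close> and \<open>c\<close>.\<close>
  have on: "u a = 0" if abc: "{a, b, c} = {p, q, r}" "distinct [a, b, c]" for a b c
  proof -
    have "{a, b, c} \<subseteq> ?Y" "m \<notin> {a, b, c}"
      unfolding abc(1) using pqr(1) m by blast+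
    then have sub: "{a, b, c, m} \<subseteq> {..<s}" "distinct [a, b, c, m]" using abc(2) m by auto
    obtain N where N: "N \<noteq> 0" "N \<bullet> v b = 0" "N \<bullet> v m = 0"
      using hyperplane_through_two[OF n] by blast
    have "N \<bullet> v a \<noteq> 0"
    proof
      assume "N \<bullet> v a = 0"
      then have "on_hyperplane {a, b, m}"
        unfolding on_hyperplane_def using N by blast
      moreover have "on_hyperplane {a, b, c}" using cop abc(1) by simp
      moreover have "independent (v ` {a, b})" "card (v ` {a, b}) = CARD('n) - 1"
        using independent_pair[of a b] sub n by auto
      ultimately have "on_hyperplane ({a, b, m} \<union> {a, b, c})"
        using on_hyperplane_Un[of "{a, b}" "{a, b, m}" "{a, b, c}"] by blast
      then have "on_hyperplane {a, b, c, m}" by (rule on_hyperplane_mono) auto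
      then show False
        using no_four_collinear_cubics[OF d n sub] by blast
    qed
    moreover have "u a * (N \<bullet> v a) = 0"
    proof (rule five[where Y = "{a, c}"])
      show "card {a, c} \<le> 5" by (simp add: card_insert_if)
      show "u k * (N \<bullet> v k) = 0" if "k < s" "k \<notin> {a, c}" for k
      proof (cases "k = j \<or> k = b")
        case True then show ?thesis using N ij by auto
      next
        case False
        then have "k \<in> ?Y - {p, q, r}" using that abc(1)[symmetric] by auto
        then show ?thesis using out by simp
      qed
    qed (use sub s in auto)
    ultimately show ?thesis by simp
  qed
  have "u p = 0" "u q = 0" "u r = 0"
    using on[of p q r] on[of q p r] on[of r p q] pqr(2) by auto
  then show False using out[of i] ij by auto
qed

lemma dual_functional:
  assumes n: "CARD('n) = 3" and "\<not> on_hyperplane {p, q, r}"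
  obtains b where "b \<bullet> v p = 1" "b \<bullet> v q = 0" "b \<bullet> v r = 0"
proof -
  obtain a where a: "a \<noteq> 0" "a \<bullet> v q = 0" "a \<bullet> v r = 0"
    by (rule hyperplane_through_two[OF n])
  then have "a \<bullet> v p \<noteq> 0"
    using assms(2) unfolding on_hyperplane_def by blast
  then show ?thesis
    by (intro that[of "(1 / (a \<bullet> v p)) *\<^sub>R a"]) (use a in auto)
qed

text \<open>A relation with \<open>u j = 0\<close> lives on eight points, no three of them
  collinear. A linear factor through two of them leaves a relation on six, which puts the six on a
  conic. Varying the two puts all eight on one conic, more than the bound \<open>2 * d = 6\<close>
  allows.\<close>

lemma cubics_full_support:
  assumes d: "d = 3" and n: "CARD('n) = 3" and s: "s = 9" and u: "forms_relation u"
    and ij: "i < s" "j < s" "u i \<noteq> 0"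
  shows "u j \<noteq> 0"
proof
  assume uj: "u j = 0"
  let ?Y = "{..<s} - {j}"
  note five = quadric_relation_five_points[OF d n _ forms_relation_quadric_cubics[OF d u]]
  have cY: "card ?Y = 8" using s ij(2) by simp
  have tri: "\<not> on_hyperplane {p, q, r}" if "{p, q, r} \<subseteq> ?Y" "distinct [p, q, r]" for p q r
    using cubics_no_three_collinear[OF d n s u ij uj that] by blast
  \<comment> \<open>With a second zero weight, a line through two more points would cut the support
    to five points, and those carry no relation.\<close>
  have u_nz: "u m \<noteq> 0" if m: "m \<in> ?Y" for m
  proof
    assume um: "u m = 0"
    have "m \<noteq> i" using um ij by auto
    have "card (?Y - {i, m}) = 6"
      using \<open>m \<noteq> i\<close> m ij uj cY by (subst card_Diff_subset) auto
    then obtain xs where xs: "set xs = ?Y - {i, m}" "distinct xs" "length xs = 6"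
      using finite_distinct_list[of "?Y - {i, m}"] distinct_card by force
    then obtain a b c e g h where abc: "xs = [a, b, c, e, g, h]"
      by (auto simp: eval_nat_numeral length_Suc_conv)
    obtain N where N: "N \<noteq> 0" "N \<bullet> v a = 0" "N \<bullet> v b = 0"
      by (rule hyperplane_through_two[OF n])
    have "N \<bullet> v i \<noteq> 0"
    proof
      assume "N \<bullet> v i = 0"
      then have "on_hyperplane {i, a, b}"
        unfolding on_hyperplane_def using N by blast
      moreover have "{i, a, b} \<subseteq> ?Y" "distinct [i, a, b]"
        using xs abc ij uj by auto
      ultimately show False using tri by blast
    qed
    moreover have "u i * (N \<bullet> v i) = 0"
    proof (rule five[where Y = "{i, c, e, g, h}"])
      show "card {i, c, e, g, h} \<le> 5" by (simp add: card_insert_if)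
      show "{i, c, e, g, h} \<subseteq> {..<s}" using xs(1) abc ij by auto
      show "u k * (N \<bullet> v k) = 0" if "k < s" "k \<notin> {i, c, e, g, h}" for k
      proof -
        have "k \<in> insert j (insert m (insert i (set xs)))"
          using that(1) unfolding xs(1) by blast
        then show ?thesis using that(2) abc N um uj by auto
      qed
    qed (use s ij in auto)
    ultimately show False using ij by simp
  qed
  obtain xs where xs: "set xs = ?Y" "distinct xs" "length xs = 8"
    using finite_distinct_list[of ?Y] cY distinct_card by force
  then obtain P Q R X Z V1 V2 V3 where abc: "xs = [P, Q, R, X, Z, V1, V2, V3]"
    by (auto simp: eval_nat_numeral length_Suc_conv)
  have Y: "?Y = {P, Q, R, X, Z, V1, V2, V3}" and ne: "distinct [P, Q, R, X, Z, V1, V2, V3]"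
    using xs abc by auto
  have lt: "P < s" "Q < s" "R < s" "X < s" "Z < s" using Y by auto
  have tri': "\<not> on_hyperplane {p, q, r}"
    if "p \<in> {P, Q, R, X, Z, V1, V2, V3}" "q \<in> {P, Q, R, X, Z, V1, V2, V3}"
      "r \<in> {P, Q, R, X, Z, V1, V2, V3}" "p \<noteq> q" "p \<noteq> r" "q \<noteq> r" for p q r
    using tri[of p q r] that unfolding Y by simp
  have PQR: "\<not> on_hyperplane {P, Q, R}" "\<not> on_hyperplane {Q, P, R}" "\<not> on_hyperplane {R, P, Q}"
    using tri'[of P Q R] tri'[of Q P R] tri'[of R P Q] ne by auto
  obtain b1 where b1: "b1 \<bullet> v P = 1" "b1 \<bullet> v Q = 0" "b1 \<bullet> v R = 0"
    by (rule dual_functional[OF n PQR(1)])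
  obtain b2 where b2: "b2 \<bullet> v Q = 1" "b2 \<bullet> v P = 0" "b2 \<bullet> v R = 0"
    by (rule dual_functional[OF n PQR(2)])
  obtain b3 where b3: "b3 \<bullet> v R = 1" "b3 \<bullet> v P = 0" "b3 \<bullet> v Q = 0"
    by (rule dual_functional[OF n PQR(3)])
  have indep: "a = 0 \<and> b = 0 \<and> c = 0" if "a *\<^sub>R v P + b *\<^sub>R v Q + c *\<^sub>R v R = 0" for a b c
    using arg_cong[OF that, of "(\<bullet>) b1"] arg_cong[OF that, of "(\<bullet>) b2"] arg_cong[OF that, of "(\<bullet>) b3"]
    by (simp add: inner_add_right b1 b2 b3)
  have S: "independent (v ` {P, Q, R})" "card (v ` {P, Q, R}) = 3"
    using independent_triple[OF indep] lt ne by simp_all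
  have coord: "v m = (b1 \<bullet> v m) *\<^sub>R v P + (b2 \<bullet> v m) *\<^sub>R v Q + (b3 \<bullet> v m) *\<^sub>R v R" for m
  proof -
    have "UNIV \<subseteq> span (v ` {P, Q, R})"
      using card_ge_dim_independent[OF _ S(1), of UNIV] S(2) n by simp
    then have "v m \<in> span (v ` {P, Q, R})" by blast
    then obtain x1 x2 x3 where "v m - x1 *\<^sub>R v P - x2 *\<^sub>R v Q = x3 *\<^sub>R v R"
      by (auto simp: span_breakdown_eq)
    then have m: "v m = x1 *\<^sub>R v P + x2 *\<^sub>R v Q + x3 *\<^sub>R v R"
      by (simp add: algebra_simps)
    then show ?thesis by (simp add: inner_add_right b1 b2 b3)
  qed
  have nz: "b1 \<bullet> v m \<noteq> 0" "b2 \<bullet> v m \<noteq> 0" "b3 \<bullet> v m \<noteq> 0" if m: "m \<in> {X, Z, V1, V2, V3}" for m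
  proof -
    have m': "m \<noteq> P" "m \<noteq> Q" "m \<noteq> R" "m \<in> {P, Q, R, X, Z, V1, V2, V3}" using m ne by auto
    have b0: "b1 \<noteq> 0" "b2 \<noteq> 0" "b3 \<noteq> 0" using b1 b2 b3 by auto
    have h: "\<not> on_hyperplane {m, Q, R}" "\<not> on_hyperplane {m, P, R}" "\<not> on_hyperplane {m, P, Q}"
      using tri'[of m Q R] tri'[of m P R] tri'[of m P Q] m' ne by simp_all
    show "b1 \<bullet> v m \<noteq> 0" "b2 \<bullet> v m \<noteq> 0" "b3 \<bullet> v m \<noteq> 0"
      using h b1 b2 b3 b0 unfolding on_hyperplane_def by blast+
  qed
  define x1 x2 x3 y1 y2 y3 where x: "x1 = b1 \<bullet> v X" "x2 = b2 \<bullet> v X" "x3 = b3 \<bullet> v X"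
    and y: "y1 = b1 \<bullet> v Z" "y2 = b2 \<bullet> v Z" "y3 = b3 \<bullet> v Z"
  have nx: "x1 \<noteq> 0" "x2 \<noteq> 0" "x3 \<noteq> 0" and ny: "y1 \<noteq> 0" "y2 \<noteq> 0" "y3 \<noteq> 0"
    using nz[of X] nz[of Z] unfolding x y by auto
  have X: "v X = x1 *\<^sub>R v P + x2 *\<^sub>R v Q + x3 *\<^sub>R v R" unfolding x by (rule coord)
  have XZ: "\<not> on_hyperplane {X, Z, P}" "\<not> on_hyperplane {X, Z, Q}" "\<not> on_hyperplane {X, Z, R}"
    using tri'[of X Z P] tri'[of X Z Q] tri'[of X Z R] ne by auto
  have ne1: "x1 * y2 \<noteq> x2 * y1"
  proof
    assume eq: "x1 * y2 = x2 * y1"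
    \<comment> \<open>If this minor vanishes, \<open>?a\<close> is a nonzero linear form with zeros
      at \<open>X\<close>, \<open>Z\<close> and \<open>R\<close>, which would be collinear.\<close>
    let ?a = "x2 *\<^sub>R b1 - x1 *\<^sub>R b2"
    have "?a \<bullet> v P = x2" "?a \<bullet> v X = 0" "?a \<bullet> v Z = 0" "?a \<bullet> v R = 0"
      using eq by (simp_all add: inner_diff_left b1 b2 b3 flip: x y)
    then show False using XZ(3) nx(2) unfolding on_hyperplane_def by (metis (no_types) insertE inner_zero_left singletonD)
  qed
  have ne2: "x1 * y3 \<noteq> x3 * y1"
  proof
    assume eq: "x1 * y3 = x3 * y1"
    let ?a = "x3 *\<^sub>R b1 - x1 *\<^sub>R b3"
    have "?a \<bullet> v P = x3" "?a \<bullet> v X = 0" "?a \<bullet> v Z = 0" "?a \<bullet> v Q = 0"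
      using eq by (simp_all add: inner_diff_left b1 b2 b3 flip: x y)
    then show False using XZ(2) nx(3) unfolding on_hyperplane_def by (metis (no_types) insertE inner_zero_left singletonD)
  qed
  have ne3: "x2 * y3 \<noteq> x3 * y2"
  proof
    assume eq: "x2 * y3 = x3 * y2"
    let ?a = "x3 *\<^sub>R b2 - x2 *\<^sub>R b3"
    have "?a \<bullet> v Q = x3" "?a \<bullet> v X = 0" "?a \<bullet> v Z = 0" "?a \<bullet> v P = 0"
      using eq by (simp_all add: inner_diff_left b1 b2 b3 flip: x y)
    then show False using XZ(1) nx(3) unfolding on_hyperplane_def by (metis (no_types) insertE inner_zero_left singletonD)
  qed
  \<comment> \<open>\<open>V\<close> lies on the conic through \<open>P\<close>, \<open>Q\<close>,
    \<open>R\<close>, \<open>X\<close>, \<open>Z\<close>: products of two different coordinate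
    functionals vanish at \<open>P\<close>, \<open>Q\<close> and \<open>R\<close>, so the relation
    left by a line through \<open>V'\<close> and \<open>V''\<close> compares only \<open>X\<close>,
    \<open>Z\<close> and \<open>V\<close>.\<close>
  have conic: "\<exists>A B. B \<noteq> 0 \<and> 1 / (b1 \<bullet> v V) = A / x1 + B / y1 \<and> 1 / (b2 \<bullet> v V) = A / x2 + B / y2
      \<and> 1 / (b3 \<bullet> v V) = A / x3 + B / y3"
    if V: "{V, V', V''} = {V1, V2, V3}" "distinct [V, V', V'']" for V V' V''
  proof -
    have in5: "V \<in> {X, Z, V1, V2, V3}" using V(1) by blast
    have Y': "?Y = {P, Q, R, X, Z, V, V', V''}" unfolding Y using V(1) by blast
    have ne': "distinct [P, Q, R, X, Z, V, V', V'']"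
    proof -
      have "{V, V', V''} \<inter> {P, Q, R, X, Z} = {}" unfolding V(1) using ne by auto
      then show ?thesis using ne V(2) by auto
    qed
    define z1 z2 z3 where z: "z1 = b1 \<bullet> v V" "z2 = b2 \<bullet> v V" "z3 = b3 \<bullet> v V"
    have z0: "z1 \<noteq> 0" "z2 \<noteq> 0" "z3 \<noteq> 0" using nz[OF in5] unfolding z by auto
    obtain N where N: "N \<noteq> 0" "N \<bullet> v V' = 0" "N \<bullet> v V'' = 0"
      by (rule hyperplane_through_two[OF n])
    define w where "w = (\<lambda>m. u m * (N \<bullet> v m))"
    have w_nz: "w m \<noteq> 0" if "m \<in> {X, Z, V}" for m
    proof -
      have "{m, V', V''} \<subseteq> ?Y" "distinct [m, V', V'']" using that ne' unfolding Y' by auto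
      then have "\<not> on_hyperplane {m, V', V''}" by (rule tri)
      then have "N \<bullet> v m \<noteq> 0"
        unfolding on_hyperplane_def using N by blast
      moreover have "m \<in> ?Y" using that unfolding Y' by blast
      ultimately show ?thesis unfolding w_def using u_nz by simp
    qed
    have rel: "w X * (a \<bullet> v X) * (b \<bullet> v X) + w Z * (a \<bullet> v Z) * (b \<bullet> v Z)
        + w V * (a \<bullet> v V) * (b \<bullet> v V) = 0"
      if ab: "(a \<bullet> v P) * (b \<bullet> v P) = 0" "(a \<bullet> v Q) * (b \<bullet> v Q) = 0" "(a \<bullet> v R) * (b \<bullet> v R) = 0"
      for a b
    proof -
      let ?t = "\<lambda>m. w m * (a \<bullet> v m) * (b \<bullet> v m)"
      have "0 = (\<Sum>m<s. ?t m)"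
        using forms_relation_quadric_cubics[OF d u, of N]
        unfolding quadric_relation_def w_def by simp
      also have "\<dots> = (\<Sum>m\<in>{X, Z, V}. ?t m)"
      proof (rule sum.mono_neutral_right)
        show "\<forall>m\<in>{..<s} - {X, Z, V}. ?t m = 0"
        proof
          fix m assume m: "m \<in> {..<s} - {X, Z, V}"
          then have "m \<in> insert j ?Y" by blast
          then have "m \<in> {j, V', V'', P, Q, R}" using m unfolding Y' by blast
          then show "?t m = 0"
            using ab uj N unfolding w_def by (auto simp: mult.assoc)
        qed
      qed (use Y' in auto)
      finally show ?thesis using ne' by (simp add: add.assoc)
    qed
    have e: "w X * x1 * x2 + w Z * y1 * y2 + w V * z1 * z2 = 0"
      "w X * x1 * x3 + w Z * y1 * y3 + w V * z1 * z3 = 0"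
      "w X * x2 * x3 + w Z * y2 * y3 + w V * z2 * z3 = 0"
      using rel[of b1 b2] rel[of b1 b3] rel[of b2 b3] unfolding x y z by (auto simp: b1 b2 b3)
    let ?D = "w V * z1 * z2 * z3"
    have D: "?D \<noteq> 0" using w_nz[of V] z0 by simp
    \<comment> \<open>Division by \<open>?D\<close> makes the three equations linear in the inverted
      coordinates, \<open>1 / z1 = A / x1 + B / y1\<close> and its analogues, which dictates
      \<open>A\<close> and \<open>B\<close>.\<close>
    define A B where "A = - (w X * x1 * x2 * x3) / ?D" and "B = - (w Z * y1 * y2 * y3) / ?D"
    have "B \<noteq> 0" unfolding B_def using D w_nz[of Z] ny by simp
    moreover have "A / x1 + B / y1 = - (w X * x2 * x3 + w Z * y2 * y3) / ?D"
      "A / x2 + B / y2 = - (w X * x1 * x3 + w Z * y1 * y3) / ?D"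
      "A / x3 + B / y3 = - (w X * x1 * x2 + w Z * y1 * y2) / ?D"
      unfolding A_def B_def using nx ny by (simp_all add: add_divide_distrib diff_divide_distrib)
    moreover have "- (w X * x2 * x3 + w Z * y2 * y3) = w V * z2 * z3"
      "- (w X * x1 * x3 + w Z * y1 * y3) = w V * z1 * z3"
      "- (w X * x1 * x2 + w Z * y1 * y2) = w V * z1 * z2"
      using e by linarith+
    moreover have "w V * z2 * z3 / ?D = 1 / z1" "w V * z1 * z3 / ?D = 1 / z2" "w V * z1 * z2 / ?D = 1 / z3"
      using D by (simp_all add: divide_simps)
    ultimately show ?thesis unfolding z[symmetric] by metis
  qed
  show False
  proof (rule no_points_on_conic[where M = "{Z, V1, V2, V3}", OF lt(1-4) _ _ _ indep X nx ny ne1 ne2 ne3])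
    \<comment> \<open>With \<open>X\<close> at infinity and seven points at finite parameters there
      is even one zero more than the required \<open>2 * d + 1 = 7\<close>.\<close>
    show "2 * d \<le> card {Z, V1, V2, V3} + 3" using ne d by simp
    show "{Z, V1, V2, V3} \<subseteq> {..<s}" using Y by blast
    fix m assume m: "m \<in> {Z, V1, V2, V3}"
    have "\<exists>A B. B \<noteq> 0 \<and> 1 / (b1 \<bullet> v m) = A / x1 + B / y1 \<and> 1 / (b2 \<bullet> v m) = A / x2 + B / y2
      \<and> 1 / (b3 \<bullet> v m) = A / x3 + B / y3"
    proof (cases "m = Z")
      case True
      then show ?thesis by (intro exI[of _ 0] exI[of _ 1]) (simp add: y)
    next
      case False
      then consider "m = V1" | "m = V2" | "m = V3" using m by blast
      then show ?thesis
      proof cases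
        case 1 then show ?thesis using conic[of V1 V2 V3] ne by simp
      next
        case 2 then show ?thesis using conic[of V2 V1 V3] ne by auto
      next
        case 3 then show ?thesis using conic[of V3 V1 V2] ne by auto
      qed
    qed
    moreover have "m \<in> {X, Z, V1, V2, V3}" using m by blast
    ultimately show "\<exists>z1 z2 z3 A B. v m = z1 *\<^sub>R v P + z2 *\<^sub>R v Q + z3 *\<^sub>R v R \<and>
        z1 \<noteq> 0 \<and> z2 \<noteq> 0 \<and> z3 \<noteq> 0 \<and> B \<noteq> 0 \<and>
        1 / z1 = A / x1 + B / y1 \<and> 1 / z2 = A / x2 + B / y2 \<and> 1 / z3 = A / x3 + B / y3"
      using coord[of m] nz[of m] by blast
  qed (use ne in auto)
qed

end

subsection \<open>Gradients and syzygies\<close>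

lemma differentiable_prod_finite:
  fixes g :: "'i \<Rightarrow> 'a::real_normed_vector \<Rightarrow> real"
  assumes "finite A" "\<And>i. i \<in> A \<Longrightarrow> g i differentiable (at x)"
  shows "(\<lambda>x. \<Prod>i\<in>A. g i x) differentiable (at x)"
  using assms by (induction A rule: finite_induct) auto

lemma eval_poly_differentiable:
  fixes x :: "real ^ 'n::finite"
  shows "eval_poly p differentiable (at x)"
proof -
  have "(\<lambda>x :: real ^ 'n. x $ i) differentiable (at x)" for i
    using bounded_linear_imp_differentiable[OF bounded_linear_vec_nth] .
  then have "(\<lambda>x. \<Sum>m\<in>Poly_Mapping.keys p.
      of_real (Poly_Mapping.lookup p m) * (\<Prod>i\<in>UNIV. (x $ i) ^ Poly_Mapping.lookup m i)) differentiable (at x)"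
    by (intro differentiable_sum ballI differentiable_mult differentiable_const differentiable_prod_finite
        differentiable_power) auto
  then show ?thesis by (simp add: eval_poly_def[abs_def])
qed

lemma field_differentiable_prod_finite:
  fixes g :: "'i \<Rightarrow> complex \<Rightarrow> complex"
  assumes "finite A" "\<And>i. i \<in> A \<Longrightarrow> g i field_differentiable (at x)"
  shows "(\<lambda>x. \<Prod>i\<in>A. g i x) field_differentiable (at x)"
  using assms by (induction A rule: finite_induct) (auto intro: field_differentiable_mult)

lemma eval_poly_axis_field_differentiable:
  "(\<lambda>t. eval_poly p (\<chi> i. if i = j then t else z $ i)) field_differentiable (at (t :: complex))"
proof -
  have "(\<lambda>t. if i = j then t else z $ i) field_differentiable (at t)" for i
    by (cases "i = j") (auto intro: field_differentiable_ident field_differentiable_const)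
  then show ?thesis
    unfolding eval_poly_def
    by (intro field_differentiable_sum field_differentiable_mult field_differentiable_const
        field_differentiable_prod_finite) (auto intro: field_differentiable_power)
qed

text \<open>\<open>gradient\<close> is built from complex partial derivatives. Restricted to the
  real axis through a real point, the polynomial has real values, so each complex partial derivative
  there equals the real one.\<close>

lemma real_gradient:
  fixes x :: "real ^ 'n::finite"
  obtains r where "(eval_poly p has_derivative (\<lambda>w. r \<bullet> w)) (at x)"
    and "gradient p (complexify x) = complexify r"
proof -
  obtain D where D: "(eval_poly p has_derivative D) (at x)"
    using eval_poly_differentiable unfolding differentiable_def by blast
  then have lin: "linear D" by (rule has_derivative_linear)
  define r where "r = (\<chi> j. D (axis j 1))"
  have "D w = r \<bullet> w" for w
  proof -
    have "D w = D (\<Sum>j\<in>UNIV. w $ j *\<^sub>R axis j 1)"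
      using basis_expansion[of w] by (simp add: scalar_mult_eq_scaleR)
    also have "\<dots> = (\<Sum>j\<in>UNIV. w $ j * D (axis j 1))"
      using lin by (simp add: linear_sum linear_cmul)
    finally show ?thesis by (simp add: r_def inner_vec_def mult.commute)
  qed
  then have "D = (\<lambda>w. r \<bullet> w)" by blast
  then have 1: "(eval_poly p has_derivative (\<lambda>w. r \<bullet> w)) (at x)"
    using D by simp
  have "gradient p (complexify x) $ j = complex_of_real (r $ j)" for j
  proof -
    let ?g = "\<lambda>t. eval_poly p (\<chi> i. if i = j then t else complexify x $ i)"
    let ?h = "\<lambda>t. x + (t - x $ j) *\<^sub>R axis j 1"
    have "gradient p (complexify x) $ j = deriv ?g (complex_of_real (x $ j))"
      unfolding gradient_def by (simp add: complexify_def)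
    then have "(?g has_field_derivative gradient p (complexify x) $ j) (at (complex_of_real (x $ j)))"
      using eval_poly_axis_field_differentiable by (simp only: DERIV_deriv_iff_field_differentiable)
    then have c: "((?g \<circ> of_real) has_vector_derivative 1 * (gradient p (complexify x) $ j)) (at (x $ j))"
      by (intro field_vector_diff_chain_at) (auto intro!: derivative_eq_intros)
    have eq: "(?g \<circ> of_real) t = of_real (eval_poly p (?h t))" for t
    proof -
      have "(\<chi> i. if i = j then complex_of_real t else complexify x $ i) = complexify (?h t)"
        by (simp add: vec_eq_iff complexify_def axis_def)
      then show ?thesis by (simp add: eval_poly_complexify)
    qed
    have "(?h has_derivative (\<lambda>t. t *\<^sub>R axis j 1)) (at (x $ j))"
      by (auto intro!: derivative_eq_intros)
    moreover have "(eval_poly p has_derivative (\<lambda>w. r \<bullet> w)) (at (?h (x $ j)))"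
      using 1 by simp
    ultimately have "((\<lambda>t. eval_poly p (?h t)) has_derivative (\<lambda>t. r \<bullet> (t *\<^sub>R axis j 1))) (at (x $ j))"
      by (rule has_derivative_compose)
    then have "((\<lambda>t. eval_poly p (?h t)) has_vector_derivative r $ j) (at (x $ j))"
      by (simp add: has_vector_derivative_def inner_axis)
    then have "((?g \<circ> of_real) has_vector_derivative complex_of_real (r $ j)) (at (x $ j))"
      unfolding eq[abs_def] by (rule bounded_linear.has_vector_derivative[OF bounded_linear_of_real])
    then show ?thesis
      using vector_derivative_unique_at[OF c] by simp
  qed
  then have "gradient p (complexify x) = complexify r"
    by (simp add: vec_eq_iff complexify_def)
  then show ?thesis using that 1 by blast
qed

context point_configuration
begin

text \<open>A real relation among the \<open>r k\<close> is a complex relation among the gradients.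
  Quantifying over coefficient families keeps the indices over which the sums below run.\<close>

lemma independent_real_gradients:
  assumes m: "m < s"
  shows "\<exists>r. (\<forall>k<CARD('n) - 1. (eval_poly (f k) has_derivative (\<lambda>w. r k \<bullet> w)) (at (v m))) \<and>
    (\<forall>c. (\<Sum>k<CARD('n) - 1. c k *\<^sub>R r k) = 0 \<longrightarrow> (\<forall>k<CARD('n) - 1. c k = 0))"
proof -
  let ?N = "CARD('n) - 1" and ?z = "complexify (v m)"
  let ?G = "\<lambda>k. gradient (f k) ?z"
  have "\<exists>r. (eval_poly (f k) has_derivative (\<lambda>w. r \<bullet> w)) (at (v m)) \<and> ?G k = complexify r" for k
    by (rule real_gradient[of "f k" "v m"]) blast
  then obtain r where r: "\<And>k. (eval_poly (f k) has_derivative (\<lambda>w. r k \<bullet> w)) (at (v m))"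
    "\<And>k. ?G k = complexify (r k)" by metis
  have "?z \<noteq> 0" "\<forall>k<?N. eval_poly (f k) ?z = 0"
    using v_nonzero[OF m] f_zero[OF m] by (simp_all add: eval_poly_complexify)
  then have ind: "inj_on ?G {..<?N}" "vec.independent (?G ` {..<?N})"
    using transversal unfolding intersect_transversely_def by blast+
  have "c k = 0" if c: "(\<Sum>k<?N. c k *\<^sub>R r k) = 0" and k: "k < ?N" for c k
  proof -
    define q where "q = (\<lambda>g. complex_of_real (c (the_inv_into {..<?N} ?G g)))"
    have q: "q (?G k) = complex_of_real (c k)" if "k < ?N" for k
      using the_inv_into_f_f[OF ind(1)] that by (simp add: q_def)
    have "(\<Sum>g\<in>?G ` {..<?N}. q g *s g) = (\<Sum>k<?N. q (?G k) *s ?G k)"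
      using sum.reindex[OF ind(1), of "\<lambda>g. q g *s g"] by (simp only: o_def)
    also have "\<dots> = (\<Sum>k<?N. complex_of_real (c k) *s complexify (r k))"
      by (rule sum.cong) (use q r in auto)
    also have "\<dots> = complexify (\<Sum>k<?N. c k *\<^sub>R r k)"
      by (simp add: complexify_def vec_eq_iff)
    finally have "(\<Sum>g\<in>?G ` {..<?N}. q g *s g) = 0" using c by simp
    then have "q (?G k) = 0"
      by (rule vec.independentD[OF ind(2) _ order_refl, rotated]) (use k in auto)
    then show ?thesis using q[OF k] by simp
  qed
  then show ?thesis using r(1) by blast
qed

text \<open>Differentiating the relation at the common zero \<open>v m\<close> leaves a linear
  relation among the gradients of the \<open>f k\<close> whose coefficients are the values of the
  \<open>g k\<close>.\<close>

lemma syzygy_vanishes: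
  assumes g: "(\<Sum>k<CARD('n) - 1. f k * g k) = 0" and k: "k < CARD('n) - 1" and m: "m < s"
  shows "eval_poly (g k) (v m) = 0"
proof -
  let ?N = "CARD('n) - 1"
  obtain r where r: "\<And>k. k < ?N \<Longrightarrow> (eval_poly (f k) has_derivative (\<lambda>w. r k \<bullet> w)) (at (v m))"
    and ind: "\<And>c k. (\<Sum>k<?N. c k *\<^sub>R r k) = 0 \<Longrightarrow> k < ?N \<Longrightarrow> c k = 0"
    using independent_real_gradients[OF m] by metis
  have "\<exists>D. (eval_poly (g k) has_derivative D) (at (v m))" for k
    using eval_poly_differentiable[of "g k" "v m"] unfolding differentiable_def .
  then obtain D where D: "\<And>k. (eval_poly (g k) has_derivative D k) (at (v m))" by metis
  have "((\<lambda>x. \<Sum>k<?N. eval_poly (f k) x * eval_poly (g k) x) has_derivative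
      (\<lambda>w. \<Sum>k<?N. eval_poly (f k) (v m) * D k w + (r k \<bullet> w) * eval_poly (g k) (v m))) (at (v m))"
    by (intro has_derivative_sum has_derivative_mult r D) auto
  moreover have "(\<lambda>x. \<Sum>k<?N. eval_poly (f k) x * eval_poly (g k) x) = (\<lambda>x :: real ^ 'n. 0)"
  proof
    fix x :: "real ^ 'n"
    have "(\<Sum>k<?N. eval_poly (f k) x * eval_poly (g k) x) = eval_poly (\<Sum>k<?N. f k * g k) x"
      by simp
    also have "\<dots> = 0" by (subst g) simp
    finally show "(\<Sum>k<?N. eval_poly (f k) x * eval_poly (g k) x) = 0" .
  qed
  ultimately have "((\<lambda>x :: real ^ 'n. 0 :: real) has_derivative
      (\<lambda>w. \<Sum>k<?N. eval_poly (f k) (v m) * D k w + (r k \<bullet> w) * eval_poly (g k) (v m))) (at (v m))"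
    by simp
  then have "(\<lambda>w. \<Sum>k<?N. eval_poly (f k) (v m) * D k w + (r k \<bullet> w) * eval_poly (g k) (v m)) = (\<lambda>w. 0)"
    by (rule has_derivative_unique) (rule has_derivative_const)
  then have "(\<Sum>k<?N. eval_poly (f k) (v m) * D k w + (r k \<bullet> w) * eval_poly (g k) (v m)) = 0" for w
    by (rule fun_cong)
  then have "(\<Sum>k<?N. eval_poly (g k) (v m) *\<^sub>R r k) \<bullet> w = 0" for w
    using f_zero[OF m] by (simp add: inner_sum_left mult.commute)
  then have "(\<Sum>k<?N. eval_poly (g k) (v m) *\<^sub>R r k) = 0"
    using inner_eq_zero_iff by blast
  from ind[OF this k] show ?thesis .
qed

text \<open>The second-order term of the relation at \<open>v m\<close> is the quadratic form with
  matrix \<open>\<alpha>\<close> in the gradients; as these are independent, the symmetric part of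
  \<open>\<alpha>\<close> vanishes.\<close>

lemma quadratic_syzygy_antisymmetric:
  assumes rel: "(\<Sum>j<CARD('n) - 1. \<Sum>k<CARD('n) - 1. \<alpha> j k *\<^sub>R (f j * f k)) = 0"
    and jk: "j < CARD('n) - 1" "k < CARD('n) - 1" and m: "m < s"
  shows "\<alpha> j k + \<alpha> k j = 0"
proof -
  let ?N = "CARD('n) - 1"
  obtain r where r: "\<And>k. k < ?N \<Longrightarrow> (eval_poly (f k) has_derivative (\<lambda>w. r k \<bullet> w)) (at (v m))"
    and ind: "\<And>c k. (\<Sum>k<?N. c k *\<^sub>R r k) = 0 \<Longrightarrow> k < ?N \<Longrightarrow> c k = 0"
    using independent_real_gradients[OF m] by metis
  define B where "B w w' = (\<Sum>j<?N. \<Sum>k<?N. \<alpha> j k * ((r j \<bullet> w) * (r k \<bullet> w')))" for w w'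
  have BB: "B w w = 0" for w
  proof -
    let ?q = "\<lambda>k t. eval_poly (f k) (v m + t *\<^sub>R w) / t"
    have lim: "(?q k \<longlongrightarrow> r k \<bullet> w) (at 0)" if k: "k < ?N" for k
    proof -
      have "((\<lambda>t. v m + t *\<^sub>R w) has_derivative (\<lambda>t. t *\<^sub>R w)) (at 0)"
        by (auto intro!: derivative_eq_intros)
      moreover have "(eval_poly (f k) has_derivative (\<lambda>w. r k \<bullet> w)) (at (v m + 0 *\<^sub>R w))"
        using r[OF k] by simp
      ultimately have "((\<lambda>t. eval_poly (f k) (v m + t *\<^sub>R w)) has_derivative (\<lambda>t. r k \<bullet> (t *\<^sub>R w))) (at 0)"
        by (rule has_derivative_compose)
      then have "((\<lambda>t. eval_poly (f k) (v m + t *\<^sub>R w)) has_field_derivative (r k \<bullet> w)) (at 0)"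
        unfolding has_field_derivative_def by (rule has_derivative_eq_rhs) (auto simp: fun_eq_iff)
      then show ?thesis
        using f_zero[OF m k] by (simp add: DERIV_def)
    qed
    have "((\<lambda>t. \<Sum>j<?N. \<Sum>k<?N. \<alpha> j k * (?q j t * ?q k t)) \<longlongrightarrow> B w w) (at 0)"
      unfolding B_def by (intro tendsto_intros lim) auto
    \<comment> \<open>Division by 0 yields 0, so the identity also holds at t = 0, a value that the
      limit ignores anyway.\<close>
    moreover have "(\<Sum>j<?N. \<Sum>k<?N. \<alpha> j k * (?q j t * ?q k t)) = 0" for t
    proof -
      let ?x = "v m + t *\<^sub>R w"
      have "(\<Sum>j<?N. \<Sum>k<?N. \<alpha> j k * (eval_poly (f j) ?x * eval_poly (f k) ?x)) =
          eval_poly (\<Sum>j<?N. \<Sum>k<?N. \<alpha> j k *\<^sub>R (f j * f k)) ?x" by simp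
      also have "\<dots> = 0" using rel by simp
      finally have "(\<Sum>j<?N. \<Sum>k<?N. \<alpha> j k * (eval_poly (f j) ?x * eval_poly (f k) ?x)) / t\<^sup>2 = 0"
        by simp
      then show ?thesis
        by (simp add: sum_divide_distrib power2_eq_square)
    qed
    ultimately have "((\<lambda>t::real. 0) \<longlongrightarrow> B w w) (at 0)" by simp
    then show ?thesis by (auto simp: tendsto_const_iff)
  qed
  have Badd: "B (w + w') (w + w') = B w w + B w w' + B w' w + B w' w'" for w w'
    unfolding B_def by (simp add: inner_add_right algebra_simps sum.distrib)
  have "(\<Sum>k<?N. (\<Sum>j<?N. (\<alpha> j k + \<alpha> k j) * (r j \<bullet> w)) *\<^sub>R r k) \<bullet> w' = B w w' + B w' w" for w w'
  proof -
    have "B w' w = (\<Sum>k<?N. \<Sum>j<?N. \<alpha> k j * ((r k \<bullet> w') * (r j \<bullet> w)))"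
      unfolding B_def ..
    moreover have "B w w' = (\<Sum>k<?N. \<Sum>j<?N. \<alpha> j k * ((r j \<bullet> w) * (r k \<bullet> w')))"
      unfolding B_def by (rule sum.swap)
    ultimately show ?thesis
      by (simp add: inner_sum_left sum_distrib_left sum_distrib_right distrib_left distrib_right
          sum.distrib mult_ac)
  qed
  then have "(\<Sum>k<?N. (\<Sum>j<?N. (\<alpha> j k + \<alpha> k j) * (r j \<bullet> w)) *\<^sub>R r k) \<bullet> w' = 0" for w w'
    using BB Badd by (metis add.left_neutral add.right_neutral)
  then have "(\<Sum>k<?N. (\<Sum>j<?N. (\<alpha> j k + \<alpha> k j) * (r j \<bullet> w)) *\<^sub>R r k) = 0" for w
    using inner_eq_zero_iff by blast
  from ind[OF this jk(2)] have "(\<Sum>j<?N. (\<alpha> j k + \<alpha> k j) *\<^sub>R r j) \<bullet> w = 0" for w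
    by (simp add: inner_sum_left)
  then have "(\<Sum>j<?N. (\<alpha> j k + \<alpha> k j) *\<^sub>R r j) = 0"
    using inner_eq_zero_iff by blast
  from ind[OF this jk(1)] show ?thesis .
qed

end

subsection \<open>Interpolation and functionals supported on the points\<close>

lemma linear_eval_poly: "linear (\<lambda>p. eval_poly p (x :: real ^ 'n::finite))"
  by (rule linearI) simp_all

text \<open>A vector that the other functionals kill but \<open>L j\<close> does not fixes the
  coefficient of \<open>L j\<close>; if there is none, the coefficient 0 will do. The statement is
  relative to \<open>V\<close> because evaluations are compared only on forms of one degree.\<close>

lemma linear_combination_of_kernel:
  fixes L :: "'i \<Rightarrow> 'a::real_vector \<Rightarrow> real"
  assumes "finite I" and V: "subspace V" and lin: "\<And>i. i \<in> I \<Longrightarrow> linear (L i)" and l: "linear l"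
    and ker: "\<And>x. x \<in> V \<Longrightarrow> (\<And>i. i \<in> I \<Longrightarrow> L i x = 0) \<Longrightarrow> l x = 0"
  shows "\<exists>c. \<forall>x\<in>V. l x = (\<Sum>i\<in>I. c i * L i x)"
  using assms(1) lin l ker
proof (induction I arbitrary: l rule: finite_induct)
  case (insert j I)
  show ?case
  proof (cases "\<exists>y\<in>V. (\<forall>i\<in>I. L i y = 0) \<and> L j y \<noteq> 0")
    case True
    then obtain y where y: "y \<in> V" "\<And>i. i \<in> I \<Longrightarrow> L i y = 0" "L j y \<noteq> 0" by blast
    define a where "a = l y / L j y"
    have Lj: "linear (L j)" using insert by blast
    have lin': "linear (\<lambda>x. l x - a * L j x)"
      using linear_compose_sub[OF insert.prems(2) linear_compose_scale_right[OF Lj, of a]] by simp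
    have "l x - a * L j x = 0" if x: "x \<in> V" "\<And>i. i \<in> I \<Longrightarrow> L i x = 0" for x
    proof -
      let ?z = "x - (L j x / L j y) *\<^sub>R y"
      have "?z \<in> V" using x y V by (simp add: subspace_diff subspace_scale)
      moreover have "L i ?z = 0" if "i \<in> insert j I" for i
      proof -
        have "L i ?z = L i x - (L j x / L j y) * L i y"
          using insert.prems(1)[OF that] by (simp add: linear_diff linear_cmul)
        then show ?thesis using that x y by auto
      qed
      ultimately have "l ?z = 0" using insert.prems(3) by blast
      moreover have "l ?z = l x - (L j x / L j y) * l y"
        using insert.prems(2) by (simp add: linear_diff linear_cmul)
      ultimately show ?thesis by (simp add: a_def)
    qed
    then obtain c where c: "\<forall>x\<in>V. l x - a * L j x = (\<Sum>i\<in>I. c i * L i x)"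
      using insert.IH[OF _ lin'] insert.prems(1) by blast
    have "l x = (\<Sum>i\<in>insert j I. (c(j := a)) i * L i x)" if "x \<in> V" for x
    proof -
      have "(\<Sum>i\<in>I. (c(j := a)) i * L i x) = (\<Sum>i\<in>I. c i * L i x)"
        by (rule sum.cong) (use insert.hyps in auto)
      moreover have "l x - a * L j x = (\<Sum>i\<in>I. c i * L i x)" using c that by blast
      ultimately show ?thesis using insert.hyps by simp
    qed
    then show ?thesis by blast
  next
    case False
    have "l x = 0" if "x \<in> V" "\<And>i. i \<in> I \<Longrightarrow> L i x = 0" for x
      by (rule insert.prems(3)) (use that False in auto)
    then obtain c where c: "\<forall>x\<in>V. l x = (\<Sum>i\<in>I. c i * L i x)"
      using insert.IH[OF _ insert.prems(2)] insert.prems(1) by blast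
    have "l x = (\<Sum>i\<in>insert j I. (c(j := 0)) i * L i x)" if "x \<in> V" for x
    proof -
      have "(\<Sum>i\<in>I. (c(j := 0)) i * L i x) = (\<Sum>i\<in>I. c i * L i x)"
        by (rule sum.cong) (use insert.hyps in auto)
      moreover have "l x = (\<Sum>i\<in>I. c i * L i x)" using c that by blast
      ultimately show ?thesis using insert.hyps by simp
    qed
    then show ?thesis by blast
  qed
qed auto

lemma sum_remove_two:
  assumes "finite A" "i \<in> A" "j \<in> A" "i \<noteq> j"
  shows "sum g A = g i + (g j + sum g (A - {i, j}))"
proof -
  have "A - {i, j} = A - {i} - {j}" by blast
  then show ?thesis
    using assms sum.remove[of A i g] sum.remove[of "A - {i}" j g] by simp
qed

locale cayley_bacharach_configuration = point_configuration d s f v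
  for d s and f :: "nat \<Rightarrow> 'n::finite rpoly" and v :: "nat \<Rightarrow> real ^ 'n" +
  fixes u :: "nat \<Rightarrow> real"
  assumes cases: "CARD('n) = 3 \<and> d = 3 \<and> s = 9 \<or> CARD('n) = 4 \<and> d = 2 \<and> s = 8"
    and cb: "cayley_bacharach_relation d s v u"
begin

lemma s_ge: "8 \<le> s"
  using cases by auto

lemma full_support:
  assumes "forms_relation w" "i < s" "w i \<noteq> 0" "j < s" shows "w j \<noteq> 0"
  using cases
proof
  assume "CARD('n) = 3 \<and> d = 3 \<and> s = 9"
  then show ?thesis using cubics_full_support[of w i j] assms by blast
next
  assume "CARD('n) = 4 \<and> d = 2 \<and> s = 8"
  then show ?thesis
    using quadrics_full_support[of w i j] forms_relation_quadric[of w] assms by blast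
qed

lemma forms_relation_u: "forms_relation u"
  using cb unfolding forms_relation_def cayley_bacharach_relation_def by blast

lemma u_nonzero: "i < s \<Longrightarrow> u i \<noteq> 0"
  using cb full_support[OF forms_relation_u] unfolding cayley_bacharach_relation_def by blast

text \<open>Subtracting the multiple of \<open>u\<close> that cancels the weight of the point with
  index 0 leaves a relation missing a point, which full support forces to be zero.\<close>

lemma forms_relation_unique:
  assumes w: "forms_relation w" shows "\<exists>c. \<forall>i<s. w i = c * u i"
proof -
  have 0: "0 < s" using s_ge by simp
  let ?w = "\<lambda>i. w i - (w 0 / u 0) * u i"
  have "(\<Sum>m<s. ?w m * eval_poly p (v m)) =
      (\<Sum>m<s. w m * eval_poly p (v m)) - w 0 / u 0 * (\<Sum>m<s. u m * eval_poly p (v m))" for p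
    by (simp only: left_diff_distrib sum_subtractf mult.assoc sum_distrib_left)
  then have rel: "forms_relation ?w"
    using w forms_relation_u unfolding forms_relation_def by simp
  have "?w i = 0" if "i < s" for i
  proof (rule ccontr)
    assume "?w i \<noteq> 0"
    from full_support[where w = ?w, OF rel that this 0] show False
      using u_nonzero[OF 0] by simp
  qed
  then have "\<forall>i<s. w i = w 0 / u 0 * u i" unfolding right_minus_eq by blast
  then show ?thesis by blast
qed

text \<open>If every form vanishing at the other points also vanished at \<open>v i\<close>,
  evaluation at \<open>v i\<close> would be a combination of their evaluations, a relation that
  omits \<open>j\<close>. The relation \<open>u\<close> then dictates the values \<open>u j\<close>
  and \<open>- u i\<close> up to scaling.\<close>

lemma separating_form:
  assumes ij: "i < s" "j < s" "i \<noteq> j"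
  obtains p where "p \<in> forms d" "eval_poly p (v i) = u j" "eval_poly p (v j) = - u i"
    "\<And>m. m < s \<Longrightarrow> m \<noteq> i \<Longrightarrow> m \<noteq> j \<Longrightarrow> eval_poly p (v m) = 0"
proof -
  let ?I = "{..<s} - {i, j}"
  have "\<exists>p\<in>forms d. (\<forall>m\<in>?I. eval_poly p (v m) = 0) \<and> eval_poly p (v i) \<noteq> 0"
  proof (rule ccontr)
    assume "\<not> ?thesis"
    then have "\<exists>c. \<forall>p\<in>forms d. eval_poly p (v i) = (\<Sum>m\<in>?I. c m * eval_poly p (v m))"
      by (intro linear_combination_of_kernel[OF _ subspace_forms linear_eval_poly linear_eval_poly]) auto
    then obtain c where c: "\<And>p. p \<in> forms d \<Longrightarrow> eval_poly p (v i) = (\<Sum>m\<in>?I. c m * eval_poly p (v m))"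
      by blast
    define w where "w m = (if m = i then -1 else if m = j then 0 else c m)" for m
    have "forms_relation w"
      unfolding forms_relation_def
    proof
      fix p :: "'n rpoly" assume p: "p \<in> forms d"
      have "(\<Sum>m<s. w m * eval_poly p (v m)) = w i * eval_poly p (v i) + (w j * eval_poly p (v j)
          + (\<Sum>m\<in>?I. w m * eval_poly p (v m)))"
        by (rule sum_remove_two) (use ij in auto)
      also have "(\<Sum>m\<in>?I. w m * eval_poly p (v m)) = (\<Sum>m\<in>?I. c m * eval_poly p (v m))"
        by (rule sum.cong) (auto simp: w_def)
      finally show "(\<Sum>m<s. w m * eval_poly p (v m)) = 0"
        using c[OF p] ij by (simp add: w_def)
    qed
    then show False
      using full_support[of w i j] ij by (simp add: w_def)
  qed
  then obtain p where p: "p \<in> forms d" "\<forall>m\<in>?I. eval_poly p (v m) = 0" "eval_poly p (v i) \<noteq> 0"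
    by blast
  have "(\<Sum>m<s. u m * eval_poly p (v m)) = u i * eval_poly p (v i) + (u j * eval_poly p (v j)
          + (\<Sum>m\<in>?I. u m * eval_poly p (v m)))"
    by (rule sum_remove_two) (use ij in auto)
  then have rel: "u i * eval_poly p (v i) + u j * eval_poly p (v j) = 0"
    using p forms_relation_u unfolding forms_relation_def by simp
  show ?thesis
  proof (rule that[of "(u j / eval_poly p (v i)) *\<^sub>R p"])
    show "eval_poly ((u j / eval_poly p (v i)) *\<^sub>R p) (v j) = - u i"
      using rel p(3) by (simp add: field_simps)
  qed (use p in \<open>auto intro: forms_scale\<close>)
qed

text \<open>The vectors with entry \<open>u 0\<close> at \<open>i\<close>, entry
  \<open>- u i\<close> at 0 and zeros elsewhere span the hyperplane orthogonal to \<open>u\<close>,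
  and each is the value vector of a separating form.\<close>

lemma interpolating_form:
  assumes x: "(\<Sum>i<s. u i * x i) = 0"
  obtains p where "p \<in> forms d" "\<And>i. i < s \<Longrightarrow> eval_poly p (v i) = x i"
proof -
  have 0: "0 < s" using s_ge by simp
  have "\<exists>e. e \<in> forms d \<and> eval_poly e (v i) = u 0 \<and> eval_poly e (v 0) = - u i \<and>
    (\<forall>m<s. m \<noteq> i \<longrightarrow> m \<noteq> 0 \<longrightarrow> eval_poly e (v m) = 0)" if "i \<in> {1..<s}" for i
    by (rule separating_form[of i 0]) (use that 0 in auto)
  then obtain e where e: "\<And>i. i \<in> {1..<s} \<Longrightarrow> e i \<in> forms d \<and> eval_poly (e i) (v i) = u 0 \<and>
    eval_poly (e i) (v 0) = - u i \<and> (\<forall>m<s. m \<noteq> i \<longrightarrow> m \<noteq> 0 \<longrightarrow> eval_poly (e i) (v m) = 0)"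
    by metis
  let ?p = "\<Sum>i\<in>{1..<s}. (x i / u 0) *\<^sub>R e i"
  have "eval_poly ?p (v m) = x m" if m: "m < s" for m
  proof (cases "m = 0")
    case True
    have "{..<s} = insert 0 {1..<s}" using 0 by auto
    then have "u 0 * x 0 = - (\<Sum>i\<in>{1..<s}. u i * x i)" using x by simp
    moreover have "eval_poly ?p (v 0) = (\<Sum>i\<in>{1..<s}. - (u i * x i) / u 0)"
      unfolding eval_poly_sum by (rule sum.cong) (use e in simp_all)
    moreover have "(\<Sum>i\<in>{1..<s}. - (u i * x i) / u 0) = - (\<Sum>i\<in>{1..<s}. u i * x i) / u 0"
      by (simp only: sum_divide_distrib[symmetric] sum_negf)
    ultimately have "eval_poly ?p (v 0) = u 0 * x 0 / u 0" by (simp only:)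
    then show ?thesis using True u_nonzero[OF 0] by simp
  next
    case False
    have "eval_poly ?p (v m) = (\<Sum>i\<in>{1..<s}. if i = m then x m else 0)"
      unfolding eval_poly_sum
    proof (rule sum.cong)
      fix i assume "i \<in> {1..<s}"
      with e[OF this] show "eval_poly ((x i / u 0) *\<^sub>R e i) (v m) = (if i = m then x m else 0)"
        using m False u_nonzero[OF 0] by auto
    qed simp
    then show ?thesis using m False by simp
  qed
  moreover have "?p \<in> forms d" by (intro forms_sum forms_scale) (use e in blast)
  ultimately show ?thesis using that by blast
qed

text \<open>In degree \<open>d\<close> the relation \<open>u\<close> prevents a form from isolating
  a single point. In degree \<open>2 * d\<close> the product of a separating form for
  \<open>i\<close>, \<open>j\<close> and one for \<open>i\<close>, \<open>k\<close> does so.\<close>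

lemma delta_form:
  assumes i: "i < s"
  shows "\<exists>E. E \<in> forms (2 * d) \<and> (\<forall>m<s. eval_poly E (v m) = (if m = i then 1 else 0))"
proof -
  have "card ({..<s} - {i}) \<ge> 2" using i s_ge by simp
  then obtain j k where jk: "j < s" "k < s" "j \<noteq> i" "k \<noteq> i" "j \<noteq> k"
    by (auto simp: card_le_Suc_iff numeral_2_eq_2)
  obtain p where p: "p \<in> forms d" "eval_poly p (v i) = u j" "eval_poly p (v j) = - u i"
    "\<And>m. m < s \<Longrightarrow> m \<noteq> i \<Longrightarrow> m \<noteq> j \<Longrightarrow> eval_poly p (v m) = 0"
    by (rule separating_form[OF i jk(1)]) (use jk in auto)
  obtain q where q: "q \<in> forms d" "eval_poly q (v i) = u k" "eval_poly q (v k) = - u i"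
    "\<And>m. m < s \<Longrightarrow> m \<noteq> i \<Longrightarrow> m \<noteq> k \<Longrightarrow> eval_poly q (v m) = 0"
    by (rule separating_form[OF i jk(2)]) (use jk in auto)
  have "(1 / (u j * u k)) *\<^sub>R (p * q) \<in> forms (2 * d)"
    using forms_mult[OF p(1) q(1)] by (intro forms_scale) (simp add: mult_2)
  moreover have "eval_poly ((1 / (u j * u k)) *\<^sub>R (p * q)) (v m) = (if m = i then 1 else 0)" if "m < s" for m
  proof (cases "m = i")
    case True
    then show ?thesis using p(2) q(2) u_nonzero jk by simp
  next
    case False
    then have "eval_poly p (v m) = 0 \<or> eval_poly q (v m) = 0"
      using p(4)[OF that] q(4)[OF that] jk by auto
    then show ?thesis using False by auto
  qed
  ultimately show ?thesis by blast
qed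

end

section \<open>Linear functionals and nonnegativity on squares\<close>

lemma forms_dual_add: "l \<in> forms_dual k \<Longrightarrow> p \<in> forms k \<Longrightarrow> q \<in> forms k \<Longrightarrow> l (p + q) = l p + l q"
  by (simp add: forms_dual_def)

lemma forms_dual_scale: "l \<in> forms_dual k \<Longrightarrow> p \<in> forms k \<Longrightarrow> l (c *\<^sub>R p) = c * l p"
  by (simp add: forms_dual_def)

lemma forms_dual_zero: "l \<in> forms_dual k \<Longrightarrow> l 0 = 0"
  using forms_dual_scale[of l k 0 0] by (simp add: forms_zero)

lemma forms_dual_sum:
  assumes "l \<in> forms_dual k" "\<And>i. i \<in> A \<Longrightarrow> p i \<in> forms k"
  shows "l (\<Sum>i\<in>A. p i) = (\<Sum>i\<in>A. l (p i))"
  using assms(2)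
proof (induction A rule: infinite_finite_induct)
  case (insert x A)
  then show ?case
    using forms_dual_add[OF assms(1), of "p x" "sum p A"] forms_sum[of A p k] by simp
qed (simp_all add: forms_dual_zero[OF assms(1)])

lemma sos_dual_cone_iff:
  "l \<in> sos_dual_cone d \<longleftrightarrow> l \<in> forms_dual (2 * d) \<and> (\<forall>q\<in>forms d. 0 \<le> l (q ^ 2))"
proof
  assume l: "l \<in> sos_dual_cone d"
  have "q ^ 2 \<in> sos_cone d" if "q \<in> forms d" for q :: "'a rpoly"
    unfolding sos_cone_def using that forms_power2[OF that]
    by (intro CollectI conjI exI[of _ "[q]"]) auto
  then show "l \<in> forms_dual (2 * d) \<and> (\<forall>q\<in>forms d. 0 \<le> l (q ^ 2))"
    using l by (simp add: sos_dual_cone_def)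
next
  assume l: "l \<in> forms_dual (2 * d) \<and> (\<forall>q\<in>forms d. 0 \<le> l (q ^ 2))"
  have "(\<Sum>q\<leftarrow>qs. q ^ 2) \<in> forms (2 * d) \<and> 0 \<le> l (\<Sum>q\<leftarrow>qs. q ^ 2)" if "set qs \<subseteq> forms d" for qs
    using that
  proof (induction qs)
    case Nil
    then show ?case using l forms_dual_zero[of l "2 * d"] by (simp add: forms_zero)
  next
    case (Cons q qs)
    then show ?case
      using l forms_power2[of q d] forms_dual_add[of l "2 * d" "q ^ 2" "\<Sum>q\<leftarrow>qs. q ^ 2"]
      by (auto intro: forms_add)
  qed
  then show "l \<in> sos_dual_cone d"
    using l by (auto simp: sos_dual_cone_def sos_cone_def)
qed

text \<open>A null vector of a positive semidefinite form lies in its radical: along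
  \<open>g + t *\<^sub>R q\<close> the form is affine in \<open>t\<close> and bounded below, so its
  slope is zero.\<close>

lemma sos_dual_kernel:
  assumes l: "l \<in> sos_dual_cone d" and q: "q \<in> forms d" "l (q ^ 2) = 0" and g: "g \<in> forms d"
  shows "l (q * g) = 0"
proof (rule ccontr)
  assume ne: "l (q * g) \<noteq> 0"
  have lin: "l \<in> forms_dual (2 * d)" using l by (simp add: sos_dual_cone_iff)
  have qg: "q * g \<in> forms (2 * d)" using forms_mult[OF q(1) g] by (simp add: mult_2)
  note sq = forms_power2[OF q(1)] forms_power2[OF g]
  have "0 \<le> l (g ^ 2) + 2 * t * l (q * g)" for t
  proof -
    define X Y where "X = t *\<^sub>R (q * g)" and "Y = t\<^sup>2 *\<^sub>R q ^ 2"
    have X: "X \<in> forms (2 * d)" "l X = t * l (q * g)"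
      and Y: "Y \<in> forms (2 * d)" "l Y = 0"
      using qg sq q(2) by (simp_all add: X_def Y_def forms_scale forms_dual_scale[OF lin])
    have "(g + t *\<^sub>R q) ^ 2 = g ^ 2 + ((X + X) + Y)"
      unfolding X_def Y_def
      by (simp only: poly_mapping_scaleR_mult power2_eq_square distrib_left distrib_right
          scaleR_scaleR scaleR_add_right add.assoc mult.commute[of g q])
    moreover have "l (g ^ 2 + ((X + X) + Y)) = l (g ^ 2) + ((l X + l X) + l Y)"
      using X(1) Y(1) sq(2) by (simp only: forms_dual_add[OF lin] forms_add)
    moreover have "0 \<le> l ((g + t *\<^sub>R q) ^ 2)"
      using l q g by (simp add: sos_dual_cone_iff forms_add forms_scale)
    ultimately show ?thesis
      using X(2) Y(2) by simp
  qed
  \<comment> \<open>At this \<open>t\<close> the affine expression takes the value -1.\<close>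
  note nonneg = this[of "- (l (g ^ 2) + 1) / (2 * l (q * g))"]
  have "2 * (- (l (g ^ 2) + 1) / (2 * l (q * g))) * l (q * g) = - (l (g ^ 2) + 1)"
    using ne by (simp add: field_simps)
  then show False using nonneg by linarith
qed

section \<open>The dimension count in degree \<open>2 * d\<close>\<close>

context cayley_bacharach_configuration
begin

definition point_functional :: "(nat \<Rightarrow> real) \<Rightarrow> 'n rpoly \<Rightarrow> real" where
  "point_functional a p = (\<Sum>m<s. a m * eval_poly p (v m))"

lemma point_functional_dual: "point_functional a \<in> forms_dual k"
  unfolding forms_dual_def point_functional_def
  by (simp add: distrib_left sum.distrib sum_distrib_left mult_ac)

text \<open>With \<open>p\<close> added, the family is one too many for the space. In the resulting
  relation evaluation at the points removes the forms \<open>E m\<close>, and the coefficient of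
  \<open>p\<close> is nonzero since otherwise a forbidden syzygy would remain. So \<open>p\<close>
  is a combination of multiples of the \<open>f k\<close>.\<close>

lemma vanishing_form_in_kernel:
  assumes l: "l \<in> forms_dual (2 * d)"
    and ker: "\<And>k g. k < CARD('n) - 1 \<Longrightarrow> g \<in> forms d \<Longrightarrow> l (f k * g) = 0"
    and p: "p \<in> forms (2 * d)" "\<And>m. m < s \<Longrightarrow> eval_poly p (v m) = 0"
  shows "l p = 0"
proof -
  let ?N = "CARD('n) - 1"
  have 0: "0 < s" using s_ge by simp
  obtain E where E: "\<And>i. i < s \<Longrightarrow> E i \<in> forms (2 * d)"
    "\<And>i m. i < s \<Longrightarrow> m < s \<Longrightarrow> eval_poly (E i) (v m) = (if m = i then 1 else 0)"
    using delta_form by metis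
  \<comment> \<open>The value at \<open>v 0\<close> is left to the relation \<open>u\<close>: modulo
    forms vanishing at all the points, degree \<open>d\<close> has dimension \<open>s - 1\<close>,
    and the \<open>e i\<close> give a basis.\<close>
  have "\<exists>e. e \<in> forms d \<and> (\<forall>m\<in>{1..<s}. eval_poly e (v m) = (if m = i then 1 else 0))"
    if "i \<in> {1..<s}" for i
  proof (rule separating_form[of i 0])
    fix e assume e: "e \<in> forms d" "eval_poly e (v i) = u 0"
      "\<And>m. m < s \<Longrightarrow> m \<noteq> i \<Longrightarrow> m \<noteq> 0 \<Longrightarrow> eval_poly e (v m) = 0"
    show ?thesis
      by (rule exI[of _ "(1 / u 0) *\<^sub>R e"]) (use e u_nonzero[OF 0] in \<open>auto intro: forms_scale\<close>)
  qed (use that 0 in auto)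
  then obtain e where e: "\<And>i. i \<in> {1..<s} \<Longrightarrow> e i \<in> forms d"
    "\<And>i m. i \<in> {1..<s} \<Longrightarrow> m \<in> {1..<s} \<Longrightarrow> eval_poly (e i) (v m) = (if m = i then 1 else 0)"
    by metis
  \<comment> \<open>Pairs with \<open>j \<le> k\<close> list each product \<open>f k * f j\<close>
    once. In the third block the index \<open>s\<close> is reserved for \<open>p\<close>.\<close>
  define I1 where "I1 = (SIGMA k:{..<?N}. {..k})"
  define I2 where "I2 = {..<?N} \<times> {1..<s}"
  define x where "x = case_sum (case_sum (\<lambda>(k, j). f k * f j) (\<lambda>(k, i). f k * e i))
    (\<lambda>m. if m = s then p else E m)"
  have fin: "finite I1" "finite I2" by (simp_all add: I1_def I2_def)
  have "card ((I1 <+> I2) <+> {..s}) = (\<Sum>k<?N. Suc k) + ?N * (s - 1) + Suc s"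
    using fin by (simp add: card_Plus I1_def I2_def)
  \<comment> \<open>The counts are 3 + 16 + 10 = 29 against 28 for plane cubics and 6 + 21 + 9 = 36
    against 35 for space quadrics.\<close>
  also have "\<dots> > (2 * d + CARD('n) - 1) choose (2 * d)"
    using cases by (auto simp: eval_nat_numeral)
  finally have "(2 * d + CARD('n) - 1) choose (2 * d) < card ((I1 <+> I2) <+> {..s})" .
  moreover have "x i \<in> forms (2 * d)" if "i \<in> (I1 <+> I2) <+> {..s}" for i
  proof -
    have "f k * f j \<in> forms (2 * d)" if "k < ?N" "j < ?N" for k j
      using forms_mult[OF f_forms[OF that(1)] f_forms[OF that(2)]] by (simp add: mult_2)
    moreover have "f k * e i \<in> forms (2 * d)" if "k < ?N" "i \<in> {1..<s}" for k i
      using forms_mult[OF f_forms[OF that(1)] e(1)[OF that(2)]] by (simp add: mult_2)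
    ultimately show ?thesis
      using that p(1) E(1) by (auto simp: x_def I1_def I2_def)
  qed
  ultimately obtain c where c: "\<exists>i\<in>(I1 <+> I2) <+> {..s}. c i \<noteq> 0"
    "(\<Sum>i\<in>(I1 <+> I2) <+> {..s}. c i *\<^sub>R x i) = 0"
    using forms_linear_relation[of "(I1 <+> I2) <+> {..s}" "2 * d" x] fin by auto
  define \<alpha> where "\<alpha> k j = (if j \<le> k then c (Inl (Inl (k, j))) else 0)" for k j
  define \<beta> where "\<beta> k i = c (Inl (Inr (k, i)))" for k i
  define \<delta> where "\<delta> m = c (Inr m)" for m
  define G where "G k = (\<Sum>j<?N. \<alpha> k j *\<^sub>R f j) + (\<Sum>i\<in>{1..<s}. \<beta> k i *\<^sub>R e i)" for k
  have G: "G k \<in> forms d" for k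
    unfolding G_def by (intro forms_add forms_sum forms_scale) (use f_forms e(1) in auto)
  have S1: "(\<Sum>i\<in>I1. c (Inl (Inl i)) *\<^sub>R x (Inl (Inl i))) = (\<Sum>k<?N. \<Sum>j<?N. \<alpha> k j *\<^sub>R (f k * f j))"
  proof -
    have "(\<Sum>i\<in>I1. c (Inl (Inl i)) *\<^sub>R x (Inl (Inl i)))
        = (\<Sum>k<?N. \<Sum>j\<le>k. c (Inl (Inl (k, j))) *\<^sub>R (f k * f j))"
      by (simp add: I1_def sum.Sigma x_def split_def)
    also have "\<dots> = (\<Sum>k<?N. \<Sum>j<?N. \<alpha> k j *\<^sub>R (f k * f j))"
    proof (rule sum.cong[OF refl])
      fix k assume "k \<in> {..<?N}"
      then show "(\<Sum>j\<le>k. c (Inl (Inl (k, j))) *\<^sub>R (f k * f j)) = (\<Sum>j<?N. \<alpha> k j *\<^sub>R (f k * f j))"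
        by (intro sum.mono_neutral_cong_left) (auto simp: \<alpha>_def)
    qed
    finally show ?thesis .
  qed
  have S2: "(\<Sum>i\<in>I2. c (Inl (Inr i)) *\<^sub>R x (Inl (Inr i))) = (\<Sum>k<?N. \<Sum>i\<in>{1..<s}. \<beta> k i *\<^sub>R (f k * e i))"
    by (simp add: I2_def sum.Sigma x_def split_def \<beta>_def)
  have S3: "(\<Sum>m\<le>s. c (Inr m) *\<^sub>R x (Inr m)) = \<delta> s *\<^sub>R p + (\<Sum>m<s. \<delta> m *\<^sub>R E m)"
  proof -
    have "{..s} = insert s {..<s}" by auto
    then show ?thesis by (simp add: x_def \<delta>_def)
  qed
  have S12: "(\<Sum>k<?N. \<Sum>j<?N. \<alpha> k j *\<^sub>R (f k * f j)) + (\<Sum>k<?N. \<Sum>i\<in>{1..<s}. \<beta> k i *\<^sub>R (f k * e i))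
      = (\<Sum>k<?N. f k * G k)"
    by (simp add: G_def distrib_left sum_distrib_left sum.distrib poly_mapping_scaleR_mult)
  have rel: "(\<Sum>k<?N. f k * G k) + (\<delta> s *\<^sub>R p + (\<Sum>m<s. \<delta> m *\<^sub>R E m)) = 0"
    using c(2) fin unfolding S12[symmetric] S1[symmetric] S2[symmetric] S3[symmetric]
    by (simp add: sum.Plus o_def)
  have \<delta>0: "\<delta> m = 0" if m: "m < s" for m
  proof -
    have "eval_poly ((\<Sum>k<?N. f k * G k) + (\<delta> s *\<^sub>R p + (\<Sum>m<s. \<delta> m *\<^sub>R E m))) (v m) = 0"
      by (subst rel) simp
    moreover have "(\<Sum>i<s. \<delta> i * eval_poly (E i) (v m)) = (\<Sum>i<s. if i = m then \<delta> m else 0)"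
      by (rule sum.cong) (use E(2) m in auto)
    ultimately show ?thesis using f_zero[OF m] p(2)[OF m] m by simp
  qed
  then have rel': "(\<Sum>k<?N. f k * G k) + \<delta> s *\<^sub>R p = 0" using rel by simp
  have fG: "f k * G k \<in> forms (2 * d)" if "k < ?N" for k
    using forms_mult[OF f_forms[OF that] G] by (simp add: mult_2)
  have "(\<Sum>k<?N. f k * G k) \<in> forms (2 * d)"
    by (intro forms_sum) (use fG in simp)
  then have "l ((\<Sum>k<?N. f k * G k) + \<delta> s *\<^sub>R p) = l (\<Sum>k<?N. f k * G k) + l (\<delta> s *\<^sub>R p)"
    by (rule forms_dual_add[OF l _ forms_scale[OF p(1)]])
  also have "l (\<Sum>k<?N. f k * G k) = (\<Sum>k<?N. l (f k * G k))"
    by (rule forms_dual_sum[OF l]) (use fG in simp)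
  also have "l (\<delta> s *\<^sub>R p) = \<delta> s * l p" by (rule forms_dual_scale[OF l p(1)])
  finally have "l ((\<Sum>k<?N. f k * G k) + \<delta> s *\<^sub>R p) = (\<Sum>k<?N. l (f k * G k)) + \<delta> s * l p" .
  then have lp: "\<delta> s * l p = 0"
    using rel' ker[OF _ G] forms_dual_zero[OF l] by simp
  have "\<delta> s \<noteq> 0"
  proof
    assume \<delta>s: "\<delta> s = 0"
    then have syz: "(\<Sum>k<?N. f k * G k) = 0" using rel' by simp
    have \<beta>0: "\<beta> k m = 0" if k: "k < ?N" and m: "m \<in> {1..<s}" for k m
    proof -
      have ms: "m < s" using m by simp
      have "0 = eval_poly (G k) (v m)" using syzygy_vanishes[OF syz k ms] by simp
      also have "\<dots> = (\<Sum>i\<in>{1..<s}. \<beta> k i * eval_poly (e i) (v m))"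
        using f_zero[OF ms] by (simp add: G_def)
      also have "\<dots> = (\<Sum>i\<in>{1..<s}. if i = m then \<beta> k m else 0)"
        by (rule sum.cong) (use e(2) m in auto)
      also have "\<dots> = \<beta> k m" using m by simp
      finally show ?thesis by simp
    qed
    have "(\<Sum>k<?N. \<Sum>j<?N. \<alpha> k j *\<^sub>R (f k * f j)) = 0"
      using syz \<beta>0 unfolding S12[symmetric] by simp
    then have \<alpha>: "\<alpha> k j + \<alpha> j k = 0" if "k < ?N" "j < ?N" for k j
      using quadratic_syzygy_antisymmetric[of \<alpha> k j 0] that 0 by blast
    \<comment> \<open>\<open>\<alpha>\<close> is lower triangular by construction, so antisymmetry
      annihilates it entry by entry.\<close>
    have \<alpha>0: "c (Inl (Inl (k, j))) = 0" if "k < ?N" "j \<le> k" for k j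
    proof (cases "j = k")
      case True
      then show ?thesis using \<alpha>[of k k] that by (simp add: \<alpha>_def)
    next
      case False
      then show ?thesis using \<alpha>[of k j] that by (simp add: \<alpha>_def)
    qed
    have "c i = 0" if "i \<in> (I1 <+> I2) <+> {..s}" for i
      using that \<alpha>0 \<beta>0[unfolded \<beta>_def] \<delta>0[unfolded \<delta>_def] \<delta>s[unfolded \<delta>_def]
      by (auto simp: I1_def I2_def le_less)
    then show False using c(1) by blast
  qed
  then show ?thesis using lp by simp
qed

text \<open>The coefficient at \<open>v m\<close> has to be the value of \<open>l\<close> at the
  form isolating \<open>v m\<close>; the difference between \<open>p\<close> and its interpolant by
  these forms vanishes at all the points.\<close>

lemma functional_supported_on_points:
  assumes l: "l \<in> forms_dual (2 * d)"
    and ker: "\<And>k g. k < CARD('n) - 1 \<Longrightarrow> g \<in> forms d \<Longrightarrow> l (f k * g) = 0"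
  shows "\<exists>a. \<forall>p\<in>forms (2 * d). l p = point_functional a p"
proof -
  obtain E where E: "\<And>i. i < s \<Longrightarrow> E i \<in> forms (2 * d)"
    "\<And>i m. i < s \<Longrightarrow> m < s \<Longrightarrow> eval_poly (E i) (v m) = (if m = i then 1 else 0)"
    using delta_form by metis
  have "l p = point_functional (\<lambda>m. l (E m)) p" if p: "p \<in> forms (2 * d)" for p
  proof -
    let ?S = "\<Sum>m<s. eval_poly p (v m) *\<^sub>R E m"
    have S: "?S \<in> forms (2 * d)" using E by (intro forms_sum forms_scale) auto
    have "eval_poly ?S (v m) = eval_poly p (v m)" if m: "m < s" for m
    proof -
      have "eval_poly ?S (v m) = (\<Sum>i<s. if i = m then eval_poly p (v m) else 0)"
        unfolding eval_poly_sum by (rule sum.cong) (use E(2) m in auto)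
      then show ?thesis using m by simp
    qed
    then have "eval_poly (p + (-1) *\<^sub>R ?S) (v m) = 0" if "m < s" for m
      unfolding eval_poly_add eval_poly_scaleR by (simp only: that) simp
    moreover have "p + (-1) *\<^sub>R ?S \<in> forms (2 * d)" by (intro forms_add forms_scale p S)
    ultimately have "l (p + (-1) *\<^sub>R ?S) = 0"
      using vanishing_form_in_kernel[OF l ker] by blast
    moreover have "l (p + (-1) *\<^sub>R ?S) = l p + (-1) * l ?S"
      using forms_dual_add[OF l p forms_scale[OF S]] forms_dual_scale[OF l S] by metis
    moreover have "l ?S = (\<Sum>m<s. l (eval_poly p (v m) *\<^sub>R E m))"
      by (rule forms_dual_sum[OF l]) (use E in \<open>auto intro: forms_scale\<close>)
    moreover have "\<dots> = (\<Sum>m<s. l (E m) * eval_poly p (v m))"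
      by (rule sum.cong) (use E forms_dual_scale[OF l] in auto)
    ultimately show ?thesis by (simp add: point_functional_def)
  qed
  then show ?thesis by blast
qed

end

subsection \<open>Extreme rays\<close>

context cayley_bacharach_configuration
begin

lemma forms_relation_eval: "p \<in> forms d \<Longrightarrow> (\<Sum>i<s. u i * eval_poly p (v i)) = 0"
  using forms_relation_u unfolding forms_relation_def by blast

lemma point_functional_power2:
  "point_functional a (q ^ 2) = (\<Sum>i<s. a i * (eval_poly q (v i))\<^sup>2)"
  by (simp add: point_functional_def)

text \<open>After polarization, \<open>a\<close> weighted by the values of any form \<open>p\<close>
  is a relation in degree \<open>d\<close>. A \<open>p\<close> that vanishes at another point
  \<open>k\<close> but not at \<open>i\<close> contradicts full support unless
  \<open>a i = 0\<close>.\<close>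

lemma representation_unique:
  assumes a: "\<And>q. q \<in> forms d \<Longrightarrow> (\<Sum>i<s. a i * (eval_poly q (v i))\<^sup>2) = 0" and i: "i < s"
  shows "a i = 0"
proof -
  have polar: "(\<Sum>i<s. a i * eval_poly p (v i) * eval_poly q (v i)) = 0"
    if p: "p \<in> forms d" and q: "q \<in> forms d" for p q
  proof -
    have "(\<Sum>i<s. a i * (eval_poly (p + q) (v i))\<^sup>2) = (\<Sum>i<s. a i * (eval_poly p (v i))\<^sup>2)
      + (\<Sum>i<s. a i * (eval_poly q (v i))\<^sup>2) + 2 * (\<Sum>i<s. a i * eval_poly p (v i) * eval_poly q (v i))"
      unfolding sum_distrib_left sum.distrib[symmetric]
      by (rule sum.cong) (simp_all add: power2_eq_square algebra_simps)
    then show ?thesis using a[OF p] a[OF q] a[OF forms_add[OF p q]] by simp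
  qed
  have "card ({..<s} - {i}) \<ge> 2" using i s_ge by simp
  then obtain j k where jk: "j < s" "k < s" "j \<noteq> i" "k \<noteq> i" "j \<noteq> k"
    by (auto simp: card_le_Suc_iff numeral_2_eq_2)
  obtain p where p: "p \<in> forms d" "eval_poly p (v i) = u j" "eval_poly p (v k) = 0"
    by (rule separating_form[OF i jk(1)]) (use jk in auto)
  have rel: "forms_relation (\<lambda>i. a i * eval_poly p (v i))"
    unfolding forms_relation_def using polar[OF p(1)] by blast
  have "a i * eval_poly p (v i) = 0"
  proof (rule ccontr)
    assume "a i * eval_poly p (v i) \<noteq> 0"
    from full_support[OF rel i this jk(2)] show False using p(3) by simp
  qed
  then show ?thesis using p(2) u_nonzero[OF jk(1)] by simp
qed

text \<open>Cauchy-Schwarz over the positive coefficients bounds \<open>(u k * x k)\<^sup>2\<close> for the negative \<open>a k\<close>.\<close>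

lemma admissible_nonneg:
  assumes a: "admissible_coeffs s u a" and x: "(\<Sum>i<s. u i * x i) = 0"
  shows "0 \<le> (\<Sum>i<s. a i * (x i)\<^sup>2)"
proof -
  obtain k where k: "k < s" "a k < 0" "\<And>i. i < s \<Longrightarrow> i \<noteq> k \<Longrightarrow> 0 < a i"
    and a0: "(\<Sum>i<s. (u i)\<^sup>2 / a i) = 0"
    using a unfolding admissible_coeffs_def by blast
  let ?I = "{..<s} - {k}"
  define S where "S = (\<Sum>i\<in>?I. (u i)\<^sup>2 / a i)"
  define T where "T = (\<Sum>i\<in>?I. a i * (x i)\<^sup>2)"
  have rm: "(\<Sum>i<s. g i) = g k + (\<Sum>i\<in>?I. g i)" for g :: "nat \<Rightarrow> real"
    by (rule sum.remove) (use k in auto)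
  have "(\<Sum>i\<in>?I. (u i / sqrt (a i)) * (sqrt (a i) * x i))\<^sup>2
      \<le> (\<Sum>i\<in>?I. (u i / sqrt (a i))\<^sup>2) * (\<Sum>i\<in>?I. (sqrt (a i) * x i)\<^sup>2)"
    by (rule Cauchy_Schwarz_ineq_sum)
  also have "(\<Sum>i\<in>?I. (u i / sqrt (a i)) * (sqrt (a i) * x i)) = (\<Sum>i\<in>?I. u i * x i)"
    by (rule sum.cong) (use k(3) in fastforce)+
  also have "(\<Sum>i\<in>?I. (u i / sqrt (a i))\<^sup>2) = S"
    unfolding S_def by (rule sum.cong) (use k(3) in \<open>auto simp: power_divide less_imp_le\<close>)
  also have "(\<Sum>i\<in>?I. (sqrt (a i) * x i)\<^sup>2) = T"
    unfolding T_def by (rule sum.cong) (use k(3) in \<open>auto simp: power_mult_distrib less_imp_le\<close>)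
  also have "(\<Sum>i\<in>?I. u i * x i) = - (u k * x k)"
    using x rm[of "\<lambda>i. u i * x i"] by simp
  also have "S = - ((u k)\<^sup>2 / a k)"
    using a0 rm[of "\<lambda>i. (u i)\<^sup>2 / a i"] by (simp add: S_def)
  finally have "(u k)\<^sup>2 * (x k)\<^sup>2 \<le> (u k)\<^sup>2 * (T / - a k)"
    by (simp add: power_mult_distrib)
  moreover have "0 < (u k)\<^sup>2" using u_nonzero[OF k(1)] by simp
  ultimately have "(x k)\<^sup>2 \<le> T / - a k" by (simp only: mult_le_cancel_left_pos)
  then have "(x k)\<^sup>2 * - a k \<le> T"
    using k(2) by (subst (asm) pos_le_divide_eq) auto
  then show ?thesis
    using rm[of "\<lambda>i. a i * (x i)\<^sup>2"] by (simp add: T_def mult.commute)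
qed

lemma admissible_sos_dual:
  assumes "admissible_coeffs s u a" shows "point_functional a \<in> sos_dual_cone d"
  unfolding sos_dual_cone_iff
  using point_functional_dual admissible_nonneg[OF assms] forms_relation_eval
  by (simp add: point_functional_power2)

text \<open>Besides the \<open>f k\<close>, the kernel contains a form with values
  \<open>u i / a i\<close>. A summand \<open>l1\<close> inherits this kernel: the \<open>f k\<close>
  make it a point functional, and the extra element makes its coefficients, multiplied by
  \<open>u i / a i\<close>, a relation, hence proportional to \<open>u\<close>.\<close>

lemma admissible_extreme:
  assumes a: "admissible_coeffs s u a"
  shows "spans_extreme_ray d (point_functional a)"
proof -
  let ?l = "point_functional a"
  obtain k where k: "k < s" "a k < 0" "\<And>i. i < s \<Longrightarrow> i \<noteq> k \<Longrightarrow> 0 < a i"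
    and a0: "(\<Sum>i<s. (u i)\<^sup>2 / a i) = 0"
    using a unfolding admissible_coeffs_def by blast
  have a_nz: "a i \<noteq> 0" if "i < s" for i
    using k(2) k(3)[OF that] by (cases "i = k") auto
  \<comment> \<open>A form supported on two points with positive coefficients gives the functional a
    positive value; this fixes the sign of \<open>c\<close> and shows that the functional is
    nonzero.\<close>
  have "card ({..<s} - {k}) \<ge> 2" using k(1) s_ge by simp
  then obtain i j where ij: "i < s" "j < s" "i \<noteq> k" "j \<noteq> k" "i \<noteq> j"
    by (auto simp: card_le_Suc_iff numeral_2_eq_2)
  obtain h where h: "h \<in> forms d" "eval_poly h (v i) = u j" "eval_poly h (v j) = - u i"
    "\<And>m. m < s \<Longrightarrow> m \<noteq> i \<Longrightarrow> m \<noteq> j \<Longrightarrow> eval_poly h (v m) = 0"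
    by (rule separating_form[OF ij(1,2,5)]) blast
  have "?l (h ^ 2) = a i * (u j)\<^sup>2 + (a j * (u i)\<^sup>2 + (\<Sum>m\<in>{..<s} - {i, j}. a m * (eval_poly h (v m))\<^sup>2))"
    unfolding point_functional_power2
    by (subst sum_remove_two[of _ i j]) (use ij h(2,3) in auto)
  then have "?l (h ^ 2) = a i * (u j)\<^sup>2 + a j * (u i)\<^sup>2" using h(4) by simp
  then have lh: "?l (h ^ 2) > 0"
    using k(3) ij u_nonzero by (simp add: add_pos_pos)
  \<comment> \<open>The condition \<open>(\<Sum>i<s. (u i)\<^sup>2 / a i) = 0\<close> says exactly
    that these values are orthogonal to \<open>u\<close>, so they can be interpolated.\<close>
  obtain q where q: "q \<in> forms d" "\<And>i. i < s \<Longrightarrow> eval_poly q (v i) = u i / a i"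
  proof (rule interpolating_form[of "\<lambda>i. u i / a i"])
    show "(\<Sum>i<s. u i * (u i / a i)) = 0" using a0 by (simp add: power2_eq_square)
  qed blast
  have lq: "?l (q ^ 2) = 0"
  proof -
    have "?l (q ^ 2) = (\<Sum>i<s. (u i)\<^sup>2 / a i)"
      unfolding point_functional_power2
      by (rule sum.cong) (use q(2) a_nz in \<open>auto simp: power2_eq_square\<close>)
    then show ?thesis using a0 by simp
  qed
  have "\<exists>c\<ge>0. \<forall>p\<in>forms (2 * d). l1 p = c * ?l p"
    if l1: "l1 \<in> sos_dual_cone d" and l2: "l2 \<in> sos_dual_cone d"
      and sum: "\<forall>p\<in>forms (2 * d). ?l p = l1 p + l2 p" for l1 l2
  proof -
    have ker: "l1 (p * g) = 0" if p: "p \<in> forms d" "?l (p ^ 2) = 0" and g: "g \<in> forms d" for p g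
    proof (rule sos_dual_kernel[OF l1 p(1) _ g])
      have "0 \<le> l1 (p ^ 2)" "0 \<le> l2 (p ^ 2)" "?l (p ^ 2) = l1 (p ^ 2) + l2 (p ^ 2)"
        using l1 l2 sum p(1) forms_power2[OF p(1)] by (simp_all add: sos_dual_cone_iff)
      then show "l1 (p ^ 2) = 0" using p(2) by linarith
    qed
    have lin: "l1 \<in> forms_dual (2 * d)" using l1 by (simp add: sos_dual_cone_iff)
    have "l1 (f k * g) = 0" if "k < CARD('n) - 1" "g \<in> forms d" for k g
    proof (rule ker[OF f_forms[OF that(1)] _ that(2)])
      show "?l (f k ^ 2) = 0"
        unfolding point_functional_power2 using f_zero that(1) by simp
    qed
    then obtain b where b: "\<And>p. p \<in> forms (2 * d) \<Longrightarrow> l1 p = point_functional b p"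
      using functional_supported_on_points[OF lin] by blast
    have "forms_relation (\<lambda>i. b i * (u i / a i))"
      unfolding forms_relation_def
    proof
      fix g :: "'n rpoly" assume g: "g \<in> forms d"
      have "q * g \<in> forms (2 * d)" using forms_mult[OF q(1) g] by (simp add: mult_2)
      then have "0 = point_functional b (q * g)" using ker[OF q(1) lq g] b by simp
      also have "\<dots> = (\<Sum>i<s. b i * (u i / a i) * eval_poly g (v i))"
        unfolding point_functional_def by (rule sum.cong) (use q(2) in auto)
      finally show "(\<Sum>i<s. b i * (u i / a i) * eval_poly g (v i)) = 0" by simp
    qed
    then obtain c where c: "\<forall>i<s. b i * (u i / a i) = c * u i"
      using forms_relation_unique by blast
    have bc: "b i = c * a i" if "i < s" for i
    proof -
      have "b i * (u i / a i) = c * u i" using c that by blast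
      then have "b i * u i = c * a i * u i" using a_nz[OF that] by (simp add: field_simps)
      then show ?thesis using u_nonzero[OF that] by simp
    qed
    have l1c: "l1 p = c * ?l p" if "p \<in> forms (2 * d)" for p
    proof -
      have "(\<Sum>m<s. b m * eval_poly p (v m)) = (\<Sum>m<s. c * (a m * eval_poly p (v m)))"
        by (rule sum.cong) (use bc in auto)
      then show ?thesis
        by (simp add: b[OF that] point_functional_def sum_distrib_left)
    qed
    have "0 \<le> l1 (h ^ 2)" using l1 h(1) by (simp add: sos_dual_cone_iff)
    then have "0 \<le> c * ?l (h ^ 2)" by (simp only: l1c[OF forms_power2[OF h(1)]])
    then have "0 \<le> c" using lh by (simp add: zero_le_mult_iff)
    then show ?thesis using l1c by blast
  qed
  moreover have "\<exists>p\<in>forms (2 * d). ?l p \<noteq> 0"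
    using lh forms_power2[OF h(1)] by (intro bexI[of _ "h ^ 2"]) auto
  ultimately show ?thesis
    unfolding spans_extreme_ray_def using admissible_sos_dual[OF a] by blast
qed

text \<open>\<open>diff\<close> makes \<open>l\<close> the sum of a multiple of evaluation at
  \<open>v j\<close> and an element of the cone, so extremality would make \<open>l\<close>
  proportional to that evaluation.\<close>

lemma no_point_summand:
  assumes ext: "spans_extreme_ray d l" and npe: "\<not> is_point_evaluation d l"
    and t: "0 < t" and j: "j < s"
    and diff: "\<And>q. q \<in> forms d \<Longrightarrow> 0 \<le> l (q ^ 2) - t * (eval_poly q (v j))\<^sup>2"
  shows False
proof -
  let ?l1 = "\<lambda>p. t * eval_poly p (v j)"
  have l: "l \<in> forms_dual (2 * d)"
    using ext by (simp add: spans_extreme_ray_def sos_dual_cone_iff)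
  have "?l1 \<in> sos_dual_cone d"
    unfolding sos_dual_cone_iff using t by (simp add: forms_dual_def distrib_left)
  moreover have "(\<lambda>p. l p - ?l1 p) \<in> sos_dual_cone d"
    unfolding sos_dual_cone_iff using l diff by (simp add: forms_dual_def algebra_simps)
  ultimately obtain c where c: "\<And>p. p \<in> forms (2 * d) \<Longrightarrow> ?l1 p = c * l p"
    using ext unfolding spans_extreme_ray_def by fastforce
  obtain E where E: "E \<in> forms (2 * d)" "\<forall>m<s. eval_poly E (v m) = (if m = j then 1 else 0)"
    using delta_form[OF j] by blast
  then have "c \<noteq> 0" using c[OF E(1)] t j by auto
  then have "l p = (t / c) * eval_poly p (v j)" if "p \<in> forms (2 * d)" for p
    using c[OF that] by (simp add: field_simps)
  then show False using npe unfolding is_point_evaluation_def by blast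
qed

text \<open>Nonnegativity on the hyperplane orthogonal to \<open>u\<close> restricts the signs and
  bounds the sum of the \<open>(u i)\<^sup>2 / a i\<close> by 0 from above. Any slack left would
  allow a point evaluation to be split off.\<close>

lemma extreme_admissible:
  assumes ext: "spans_extreme_ray d l" and npe: "\<not> is_point_evaluation d l"
    and l: "\<And>p. p \<in> forms (2 * d) \<Longrightarrow> l p = point_functional a p"
  shows "admissible_coeffs s u a"
proof -
  have l2: "l (q ^ 2) = (\<Sum>i<s. a i * (eval_poly q (v i))\<^sup>2)" if "q \<in> forms d" for q
    using l[OF forms_power2[OF that]] by (simp only: point_functional_power2)
  have pos: "0 \<le> l (q ^ 2)" if "q \<in> forms d" for q
    using ext that by (simp add: spans_extreme_ray_def sos_dual_cone_iff)
  have "\<exists>k<s. a k < 0"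
  proof (rule ccontr)
    assume "\<not> ?thesis"
    then have nn: "0 \<le> a i" if "i < s" for i using that by force
    obtain p where "p \<in> forms (2 * d)" "l p \<noteq> 0"
      using ext unfolding spans_extreme_ray_def by blast
    then have "point_functional a p \<noteq> 0" using l by simp
    then obtain j where "j \<in> {..<s}" "a j * eval_poly p (v j) \<noteq> 0"
      unfolding point_functional_def by (rule sum.not_neutral_contains_not_neutral)
    then have j: "j < s" "0 < a j" using nn[of j] by auto
    show False
    proof (rule no_point_summand[OF ext npe j(2,1)])
      fix q :: "'n rpoly" assume q: "q \<in> forms d"
      have "l (q ^ 2) = a j * (eval_poly q (v j))\<^sup>2 + (\<Sum>i\<in>{..<s} - {j}. a i * (eval_poly q (v i))\<^sup>2)"
        unfolding l2[OF q] by (rule sum.remove) (use j in auto)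
      moreover have "0 \<le> (\<Sum>i\<in>{..<s} - {j}. a i * (eval_poly q (v i))\<^sup>2)"
        by (rule sum_nonneg) (use nn in auto)
      ultimately show "0 \<le> l (q ^ 2) - a j * (eval_poly q (v j))\<^sup>2" by simp
    qed
  qed
  then obtain k where k: "k < s" "a k < 0" by blast
  \<comment> \<open>On a separating form for \<open>k\<close> and \<open>i\<close> only two terms
    survive, and \<open>a k * (u i)\<^sup>2 + a i * (u k)\<^sup>2\<close> has to be nonnegative
    although \<open>a k < 0\<close>.\<close>
  have rest: "0 < a i" if i: "i < s" "i \<noteq> k" for i
  proof -
    obtain p where p: "p \<in> forms d" "eval_poly p (v k) = u i" "eval_poly p (v i) = - u k"
      "\<And>m. m < s \<Longrightarrow> m \<noteq> k \<Longrightarrow> m \<noteq> i \<Longrightarrow> eval_poly p (v m) = 0"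
      by (rule separating_form[OF k(1) i(1)]) (use i in auto)
    have "l (p ^ 2) = a k * (u i)\<^sup>2 + (a i * (u k)\<^sup>2 + (\<Sum>m\<in>{..<s} - {k, i}. a m * (eval_poly p (v m))\<^sup>2))"
      unfolding l2[OF p(1)] by (subst sum_remove_two[of _ k i]) (use i k p(2,3) in auto)
    then have "0 \<le> a k * (u i)\<^sup>2 + a i * (u k)\<^sup>2" using pos[OF p(1)] p(4) by simp
    moreover have "a k * (u i)\<^sup>2 < 0"
      using k(2) u_nonzero[OF i(1)] by (simp add: mult_neg_pos)
    ultimately have "0 < a i * (u k)\<^sup>2" by linarith
    then show ?thesis by (simp add: zero_less_mult_iff)
  qed
  let ?I = "{..<s} - {k}"
  have rm: "(\<Sum>i<s. g i) = g k + (\<Sum>i\<in>?I. g i)" for g :: "nat \<Rightarrow> real"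
    by (rule sum.remove) (use k in auto)
  define S where "S = (\<Sum>i\<in>?I. (u i)\<^sup>2 / a i)"
  have Stot: "(\<Sum>i<s. (u i)\<^sup>2 / a i) = (u k)\<^sup>2 / a k + S"
    unfolding S_def by (rule rm)
  have uk: "u k \<noteq> 0" by (rule u_nonzero[OF k(1)])
  have "?I \<noteq> {}"
  proof
    assume "?I = {}"
    then have "{..<s} \<subseteq> {k}" by blast
    then have "s \<le> 1" using card_mono[of "{k}" "{..<s}"] by simp
    then show False using s_ge by simp
  qed
  then have "0 < S"
    unfolding S_def by (intro sum_pos) (use rest u_nonzero in \<open>auto intro!: divide_pos_pos\<close>)
  have le: "(\<Sum>i<s. (u i)\<^sup>2 / a i) \<le> 0"
  proof -
    \<comment> \<open>Off \<open>k\<close> this minimizes the positive part for the given pairing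
      \<open>S\<close> with \<open>u\<close>; the entry at \<open>k\<close> makes the vector
      orthogonal to \<open>u\<close>.\<close>
    define x where "x i = (if i = k then - S / u k else u i / a i)" for i
    have ux: "(\<Sum>i\<in>?I. u i * x i) = S"
      unfolding S_def by (rule sum.cong) (auto simp: x_def power2_eq_square)
    obtain q where q: "q \<in> forms d" "\<And>i. i < s \<Longrightarrow> eval_poly q (v i) = x i"
      by (rule interpolating_form[of x]) (use rm[of "\<lambda>i. u i * x i"] ux uk in \<open>auto simp: x_def\<close>)
    have "(\<Sum>i\<in>?I. a i * (x i)\<^sup>2) = S"
      unfolding S_def
    proof (rule sum.cong)
      fix i assume "i \<in> ?I"
      then show "a i * (x i)\<^sup>2 = (u i)\<^sup>2 / a i"
        using rest[of i] by (auto simp: x_def power2_eq_square)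
    qed simp
    then have "(\<Sum>i<s. a i * (x i)\<^sup>2) = a k * (S / u k)\<^sup>2 + S"
      using rm[of "\<lambda>i. a i * (x i)\<^sup>2"] by (simp add: x_def)
    moreover have "l (q ^ 2) = (\<Sum>i<s. a i * (x i)\<^sup>2)"
      unfolding l2[OF q(1)] using q(2) by simp
    ultimately have "0 \<le> a k * (S / u k)\<^sup>2 + S" using pos[OF q(1)] by simp
    then have "0 \<le> S * (a k * S / (u k)\<^sup>2 + 1)"
      by (simp add: power2_eq_square algebra_simps)
    then have "0 \<le> a k * S / (u k)\<^sup>2 + 1"
      using \<open>0 < S\<close> by (simp add: zero_le_mult_iff)
    then have "0 \<le> a k * S + (u k)\<^sup>2"
      using uk by (simp add: field_simps)
    then show ?thesis
      unfolding Stot using k(2) by (simp add: field_simps)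
  qed
  have "(\<Sum>i<s. (u i)\<^sup>2 / a i) = 0"
  proof (rule ccontr)
    define D where "D = (\<Sum>i<s. (u i)\<^sup>2 / a i)"
    assume "(\<Sum>i<s. (u i)\<^sup>2 / a i) \<noteq> 0"
    then have D: "D < 0" using le by (simp add: D_def)
    obtain j where j: "j < s" "j \<noteq> k" using \<open>?I \<noteq> {}\<close> by blast
    have aj: "0 < a j" by (rule rest[OF j])
    have uj: "0 < (u j)\<^sup>2" using u_nonzero[OF j(1)] by simp
    \<comment> \<open>Lowering \<open>a j\<close> to \<open>b\<close> raises
      \<open>(u j)\<^sup>2 / a j\<close> by exactly \<open>- D\<close>, which brings the sum up to 0
      while \<open>b\<close> stays positive.\<close>
    define r where "r = (u j)\<^sup>2 / a j - D"
    have r: "(u j)\<^sup>2 / a j < r" "0 < r"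
      using D divide_pos_pos[OF uj aj] unfolding r_def by linarith+
    define b where "b = (u j)\<^sup>2 / r"
    have b: "0 < b" using r uj by (simp add: b_def)
    have "b < a j" using r aj by (simp add: b_def field_simps)
    define a' where "a' = a(j := b)"
    have rmj: "(\<Sum>i<s. g i) = g j + (\<Sum>i\<in>{..<s} - {j}. g i)" for g :: "nat \<Rightarrow> real"
      by (rule sum.remove) (use j in auto)
    have "(\<Sum>i\<in>{..<s} - {j}. (u i)\<^sup>2 / a' i) = (\<Sum>i\<in>{..<s} - {j}. (u i)\<^sup>2 / a i)"
      by (rule sum.cong) (auto simp: a'_def)
    moreover have "(u j)\<^sup>2 / a' j = r" using uj r by (simp add: a'_def b_def)
    ultimately have "(\<Sum>i<s. (u i)\<^sup>2 / a' i) = 0"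
      using rmj[of "\<lambda>i. (u i)\<^sup>2 / a' i"] rmj[of "\<lambda>i. (u i)\<^sup>2 / a i"] by (simp add: r_def D_def)
    then have adm: "admissible_coeffs s u a'"
      unfolding admissible_coeffs_def
      by (intro conjI exI[of _ k]) (use k rest b j in \<open>auto simp: a'_def\<close>)
    have "0 < a j - b" using \<open>b < a j\<close> by simp
    then show False
    proof (rule no_point_summand[OF ext npe _ j(1)])
      fix q :: "'n rpoly" assume q: "q \<in> forms d"
      have "(\<Sum>i\<in>{..<s} - {j}. a' i * (eval_poly q (v i))\<^sup>2) = (\<Sum>i\<in>{..<s} - {j}. a i * (eval_poly q (v i))\<^sup>2)"
        by (rule sum.cong) (auto simp: a'_def)
      then have "l (q ^ 2) - (a j - b) * (eval_poly q (v j))\<^sup>2 = (\<Sum>i<s. a' i * (eval_poly q (v i))\<^sup>2)"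
        unfolding l2[OF q] rmj[of "\<lambda>i. a' i * (eval_poly q (v i))\<^sup>2"] rmj[of "\<lambda>i. a i * (eval_poly q (v i))\<^sup>2"]
        by (simp add: a'_def algebra_simps)
      then show "0 \<le> l (q ^ 2) - (a j - b) * (eval_poly q (v j))\<^sup>2"
        using admissible_nonneg[OF adm forms_relation_eval[OF q]] by simp
    qed
  qed
  then show ?thesis
    unfolding admissible_coeffs_def using k rest by blast
qed

end

theorem theorem6p1:
  fixes d s :: nat
    and f :: "nat \<Rightarrow> 'n::finite rpoly"
    and v :: "nat \<Rightarrow> real ^ 'n"
    and u :: "nat \<Rightarrow> real"
  assumes "(CARD('n) = 3 \<and> 2 * d = 6) \<or> (CARD('n) = 4 \<and> 2 * d = 4)"
    and "s = d ^ (CARD('n) - 1)"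
    and "\<forall>i<CARD('n) - 1. f i \<in> forms d"
    and "intersect_transversely (CARD('n) - 1) f"
    and "affine_representatives s v (common_zeros (CARD('n) - 1) f)"
    and "cayley_bacharach_relation d s v u"
  shows "(\<forall>l. l \<in> forms_dual (2 * d) \<and> spans_extreme_ray d l \<and> \<not> is_point_evaluation d l \<and>
             (\<forall>i<CARD('n) - 1. f i \<in> quad_form_kernel d l) \<longrightarrow>
             (\<exists>a. represents d s v a (quad_form l) \<and> admissible_coeffs s u a \<and>
                  (\<forall>b. represents d s v b (quad_form l) \<longrightarrow> (\<forall>i<s. b i = a i)))) \<and>
         (\<forall>a. admissible_coeffs s u a \<longrightarrow>
             (\<exists>l. spans_extreme_ray d l \<and> represents d s v a (quad_form l)))"
proof -
  interpret cayley_bacharach_configuration d s f v u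
  proof
    show "0 < d" using assms(1) by auto
    show "CARD('n) = 3 \<and> d = 3 \<and> s = 9 \<or> CARD('n) = 4 \<and> d = 2 \<and> s = 8"
      using assms(1,2) by auto
  qed (use assms in blast)+
  show ?thesis
  proof (intro conjI allI impI)
    fix l :: "'n rpoly \<Rightarrow> real"
    assume l: "l \<in> forms_dual (2 * d) \<and> spans_extreme_ray d l \<and> \<not> is_point_evaluation d l \<and>
      (\<forall>i<CARD('n) - 1. f i \<in> quad_form_kernel d l)"
    then obtain a where a: "\<And>p. p \<in> forms (2 * d) \<Longrightarrow> l p = point_functional a p"
      using functional_supported_on_points[of l] unfolding quad_form_kernel_def by blast
    have "represents d s v a (quad_form l)"
      unfolding represents_def quad_form_def using a[OF forms_power2] by (simp only: point_functional_power2) simp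
    moreover have "admissible_coeffs s u a"
      using extreme_admissible[OF _ _ a] l by blast
    moreover have "b i = a i" if b: "represents d s v b (quad_form l)" and i: "i < s" for b i
    proof -
      have "(\<Sum>i<s. (b i - a i) * (eval_poly q (v i))\<^sup>2) = 0" if "q \<in> forms d" for q
        using b \<open>represents d s v a (quad_form l)\<close> that
        by (simp add: represents_def left_diff_distrib sum_subtractf)
      from representation_unique[of "\<lambda>i. b i - a i", OF this i] show ?thesis by simp
    qed
    ultimately show "\<exists>a. represents d s v a (quad_form l) \<and> admissible_coeffs s u a \<and>
        (\<forall>b. represents d s v b (quad_form l) \<longrightarrow> (\<forall>i<s. b i = a i))"
      by blast
  next
    fix a assume "admissible_coeffs s u a"
    moreover have "represents d s v a (quad_form (point_functional a))"
      unfolding represents_def quad_form_def by (simp only: point_functional_power2) simp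
    ultimately show "\<exists>l. spans_extreme_ray d l \<and> represents d s v a (quad_form l)"
      using admissible_extreme by blast
  qed
qed

end
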